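(* Let $\mathbb F\in\{\mathbb R,\mathbb C\}$ and let $\mathcal X$ be a normed space over $\mathbb F$. Then $\dim\mathcal X<\infty$ if and only if the clique number of the digraph $\Gamma_0(\mathcal X)$ is finite. If the clique number of $\Gamma_0(\mathcal X)$ is finite, then $$\dim\mathcal X=\min\Big\{|\Omega| :\ \Omega \text{ a finite subset of } \Gamma_0(\mathcal X)\text{ with } \Big|\bigcap_{x\in\Omega} x^\perp\Big| = 1\Big\}.$$ Furthermore, if $\mathcal X$ is a smooth finite-dimensional normed space and $S$ is a subset of $\Gamma_0(\mathcal X)$, then $$\mathrm{span}(S)=\bigcap_{\substack{x\in\Gamma_0(\mathcal X)\\ x\rightarrow S}} x^\perp$$ and $$\dim(\mathrm{span}(S))=\dim\mathcal X-\min\Big\{|\Omega| :\ \Omega\subseteq\Gamma_0(\mathcal X)\text{ with }\bigcap_{\substack{x\in\Omega\\ x\rightarrow S}} x^\perp=\mathrm{span}(S)\Big\}.$$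
   Context: For $x,y$ in a normed space $\mathcal X$ over $\mathbb F$, $x$ is Birkhoff--James orthogonal (BJ-orthogonal) to $y$, written $x\perp y$, if $\|x+\lambda y\|\ge\|x\|$ for all $\lambda\in\mathbb F$ (this relation need not be symmetric). $\Gamma_0(\mathcal X)$ is the directed graph whose vertices are all elements of $\mathcal X$, with a directed edge $x\rightarrow y$ if and only if $x\perp y$ (so $0$ is the only vertex with a loop). For a vertex $x$, $x^\perp=\{y : x\rightarrow y\}$ is its outgoing neighborhood. For a set $S$ of vertices, $x\rightarrow S$ means $x\rightarrow s$ for every $s\in S$. A clique is a set of pairwise connected vertices, i.e. a set of vertices such that $u\rightarrow v$ and $v\to u$ for all distinct $u,v$ in the set (pairwise BJ-orthogonal vectors); the clique number is the supremum of the cardinalities of cliques. $\mathrm{span}(S)$ is the linear span of $S$ in $\mathcal X$, regarded as a set of vertices. An intersection over an empty index set is the whole vertex set. A supporting functional of a nonzero $x$ is $f\in\mathcal X^*$ with $\|f\|=1$ and $f(x)=\|x\|$; a nonzero $x$ is smooth if it has exactly one supporting functional; a normed space is smooth if all its nonzero points are smooth. *)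

theory Defs
  imports "HOL-Analysis.Analysis" "HOL-Library.Extended_Nat" "Graph_Theory.Digraph"
begin

text \<open>
  The scalar field is \<open>\<real>\<close> or \<open>\<complex>\<close>. To state results once for both, we use a class of
  normed fields that are isometrically isomorphic to one of the two; the library types
  \<^typ>\<open>real\<close> and \<^typ>\<open>complex\<close> are instances.
\<close>

class real_or_complex = real_normed_field +
  assumes isometric_real_or_complex:
    "\<exists>\<phi> :: 'a \<Rightarrow> complex.
       (\<forall>x y. \<phi> (x + y) = \<phi> x + \<phi> y) \<and>
       (\<forall>x y. \<phi> (x * y) = \<phi> x * \<phi> y) \<and>
       (\<forall>r x. \<phi> (r *\<^sub>R x) = r *\<^sub>R \<phi> x) \<and>
       (\<forall>x. norm (\<phi> x) = norm x) \<and>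
       (range \<phi> = \<real> \<or> range \<phi> = UNIV)"

instance real :: real_or_complex
  by standard (rule exI[of _ complex_of_real], simp add: Reals_def scaleR_conv_of_real)

instance complex :: real_or_complex
  by standard (rule exI[of _ id], simp)

text \<open>
  A normed space over \<open>'k\<close>. Its norm is that of \<open>real_normed_vector\<close>, which also provides the
  underlying real normed space; the last assumption says that the real scalar multiplication of
  the class is the restriction of the given one.
\<close>

locale normed_space_over = vector_space smul
  for smul :: "'k::real_or_complex \<Rightarrow> 'a::real_normed_vector \<Rightarrow> 'a" +
  assumes norm_scale: "norm (smul c x) = norm c * norm x"
    and scale_of_real: "smul (of_real r) x = r *\<^sub>R x"

definition finite_dim :: "('k::field \<Rightarrow> 'a::ab_group_add \<Rightarrow> 'a) \<Rightarrow> bool" where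
  "finite_dim smul \<longleftrightarrow> (\<exists>B. finite B \<and> module.span smul B = UNIV)"

definition bj_orthogonal ::
    "('k::real_or_complex \<Rightarrow> 'a::real_normed_vector \<Rightarrow> 'a) \<Rightarrow> 'a \<Rightarrow> 'a \<Rightarrow> bool" where
  "bj_orthogonal smul x y \<longleftrightarrow> (\<forall>l. norm (x + smul l y) \<ge> norm x)"

definition Gamma0 ::
    "('k::real_or_complex \<Rightarrow> 'a::real_normed_vector \<Rightarrow> 'a) \<Rightarrow> ('a, 'a \<times> 'a) pre_digraph" where
  "Gamma0 smul =
     \<lparr> verts = UNIV, arcs = {(x, y). bj_orthogonal smul x y}, tail = fst, head = snd \<rparr>"

definition out_nbhd :: "('a, 'b) pre_digraph \<Rightarrow> 'a \<Rightarrow> 'a set" where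
  "out_nbhd G x = {y \<in> verts G. x \<rightarrow>\<^bsub>G\<^esub> y}"

definition is_clique :: "('a, 'b) pre_digraph \<Rightarrow> 'a set \<Rightarrow> bool" where
  "is_clique G K \<longleftrightarrow>
     K \<subseteq> verts G \<and> (\<forall>u\<in>K. \<forall>v\<in>K. u \<noteq> v \<longrightarrow> u \<rightarrow>\<^bsub>G\<^esub> v \<and> v \<rightarrow>\<^bsub>G\<^esub> u)"

text \<open>Unlike \<^const>\<open>card\<close>, this does not send infinite sets to \<open>0\<close>.\<close>

definition ecard :: "'a set \<Rightarrow> enat" where
  "ecard A = (if finite A then enat (card A) else \<infinity>)"

definition clique_number :: "('a, 'b) pre_digraph \<Rightarrow> enat" where
  "clique_number G = (SUP K \<in> {K. is_clique G K}. ecard K)"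

definition is_minimum :: "'a::order \<Rightarrow> 'a set \<Rightarrow> bool" where
  "is_minimum m A \<longleftrightarrow> m \<in> A \<and> (\<forall>a\<in>A. m \<le> a)"

text \<open>Over the given scalars \<open>f\<close> is linear; \<^const>\<open>onorm\<close> is its dual norm.\<close>

definition supporting_functional ::
    "('k::real_or_complex \<Rightarrow> 'a::real_normed_vector \<Rightarrow> 'a) \<Rightarrow> 'a \<Rightarrow> ('a \<Rightarrow> 'k) \<Rightarrow> bool" where
  "supporting_functional smul x f \<longleftrightarrow>
     Vector_Spaces.linear smul (*) f \<and> bounded_linear f \<and>
     onorm f = 1 \<and> f x = of_real (norm x)"

definition smooth_point ::
    "('k::real_or_complex \<Rightarrow> 'a::real_normed_vector \<Rightarrow> 'a) \<Rightarrow> 'a \<Rightarrow> bool" where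
  "smooth_point smul x \<longleftrightarrow> x \<noteq> 0 \<and> (\<exists>!f. supporting_functional smul x f)"

definition smooth_space ::
    "('k::real_or_complex \<Rightarrow> 'a::real_normed_vector \<Rightarrow> 'a) \<Rightarrow> bool" where
  "smooth_space smul \<longleftrightarrow> (\<forall>x. x \<noteq> 0 \<longrightarrow> smooth_point smul x)"

end

(*
  A clique consists, after normalisation, of 1-separated unit vectors, so compactness of the unit
  ball bounds it in finite dimension; conversely, n independent vectors span a space with an
  Auerbach basis, which is a clique of size n.

  By Hahn-Banach every x^perp contains the kernel of a functional, so fewer than dim X of the sets
  x^perp meet in a nonzero subspace. For the converse one needs points whose x^perp lies inside a
  hyperplane. These are contact points of the sphere with inscribed ellipsoids: there the ellipsoid
  fixes the tangent hyperplane. Making the ellipsoid long in direction v yields a hyperplane that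
  misses v, and dim X of these hyperplanes already meet in 0.

  In a smooth space every x^perp is itself the kernel of a functional. If t is a nearest point to v
  in span S, then v - t is orthogonal to S but, for v outside span S, not to v; hence the kernels
  x^perp with x -> S meet in span S, and linear algebra gives the codimension formula.
*)

theory Submission
  imports Defs "Jordan_Normal_Form.Determinant"
begin

section \<open>The scalar field\<close>

text \<open>One isometric embedding into the complex numbers is fixed by choice; real part,
  conjugation and compactness are borrowed from the plane through it.\<close>

definition emb :: "'k::real_or_complex \<Rightarrow> complex" where
  "emb = (SOME \<phi>. (\<forall>x y. \<phi> (x + y) = \<phi> x + \<phi> y) \<and> (\<forall>x y. \<phi> (x * y) = \<phi> x * \<phi> y) \<and>
     (\<forall>r x. \<phi> (r *\<^sub>R x) = r *\<^sub>R \<phi> x) \<and> (\<forall>x. norm (\<phi> x) = norm x) \<and>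
     (range \<phi> = \<real> \<or> range \<phi> = UNIV))"

lemma emb_spec:
  "(\<forall>x y :: 'k::real_or_complex. emb (x + y) = emb x + emb y) \<and>
   (\<forall>x y :: 'k. emb (x * y) = emb x * emb y) \<and>
   (\<forall>r (x :: 'k). emb (r *\<^sub>R x) = r *\<^sub>R emb x) \<and> (\<forall>x :: 'k. norm (emb x) = norm x) \<and>
   (range (emb :: 'k \<Rightarrow> complex) = \<real> \<or> range (emb :: 'k \<Rightarrow> complex) = UNIV)"
  unfolding emb_def by (rule someI_ex[OF isometric_real_or_complex])

lemma emb_add: "emb (x + y) = emb x + emb y"
  and emb_mult: "emb (x * y) = emb x * emb y"
  and emb_scaleR: "emb (r *\<^sub>R x) = r *\<^sub>R emb x"
  and norm_emb: "norm (emb x) = norm x"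
  using emb_spec by blast+

lemma range_emb:
  "range (emb :: 'k::real_or_complex \<Rightarrow> complex) = \<real> \<or> range (emb :: 'k \<Rightarrow> complex) = UNIV"
  using emb_spec by blast

lemma linear_emb: "linear emb"
  by (intro linearI emb_add emb_scaleR)

lemma emb_diff: "emb (x - y) = emb x - emb y"
  by (rule linear_diff[OF linear_emb])

lemma emb_sum: "emb (sum f A) = (\<Sum>a\<in>A. emb (f a))"
  by (rule linear_sum[OF linear_emb])

lemma dist_emb: "dist (emb x) (emb y) = dist x y"
  by (simp add: dist_norm norm_emb flip: emb_diff)

lemma inj_emb: "inj emb"
  by (metis dist_eq_0_iff dist_emb injI)

lemma emb_one [simp]: "emb (1 :: 'k::real_or_complex) = 1"
proof -
  have "emb (1 :: 'k) * emb (1 :: 'k) = (emb (1 :: 'k) :: complex)"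
    using emb_mult[of "1 :: 'k" 1] by simp
  moreover have "emb (1 :: 'k) \<noteq> (0 :: complex)"
    using norm_emb[of "1 :: 'k"] by auto
  ultimately show ?thesis
    by simp
qed

lemma emb_of_real [simp]: "emb (of_real r) = of_real r"
  by (simp add: of_real_def emb_scaleR)

text \<open>Both possible ranges of \<open>emb\<close> are closed in the plane, and the inverse of
  an isometry is continuous, so the compact disc pulls back.\<close>

lemma compact_cball_scalar: "compact (cball (0 :: 'k::real_or_complex) r)"
proof -
  let ?e = "emb :: 'k \<Rightarrow> complex"
  have "closed (range ?e)"
    using range_emb[where 'k='k] by (auto simp: closed_complex_Reals)
  hence "compact (cball 0 r \<inter> range ?e)"
    by (simp add: compact_Int_closed)
  moreover have "continuous_on (cball 0 r \<inter> range ?e) (inv_into UNIV ?e)"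
    unfolding continuous_on_iff by (auto simp: dist_emb inv_f_f[OF inj_emb])
  ultimately have "compact (inv_into UNIV ?e ` (cball 0 r \<inter> range ?e))"
    by (rule compact_continuous_image[rotated])
  also have "inv_into UNIV ?e ` (cball 0 r \<inter> range ?e) = cball 0 r"
    by (force simp: norm_emb image_iff inv_f_f[OF inj_emb])
  finally show ?thesis .
qed

section \<open>Real part and conjugation on the scalars\<close>

definition kre :: "'k::real_or_complex \<Rightarrow> real" where
  "kre z = Re (emb z)"

definition kcnj :: "'k::real_or_complex \<Rightarrow> 'k" where
  "kcnj z = inv_into UNIV emb (cnj (emb z))"

lemma emb_kcnj [simp]: "emb (kcnj z) = cnj (emb z)"
proof -
  have "cnj (emb z) \<in> range (emb :: 'a \<Rightarrow> complex)"
    using range_emb[where 'k='a] by (metis Reals_cnj_iff UNIV_I rangeI)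
  thus ?thesis
    by (simp add: kcnj_def f_inv_into_f)
qed

lemma norm_kcnj [simp]: "norm (kcnj z) = norm z"
  using norm_emb[of "kcnj z"] by (simp add: norm_emb)

lemma kre_of_real [simp]: "kre (of_real r) = r"
  by (simp add: kre_def)

lemma kre_diff: "kre (x - y) = kre x - kre y"
  by (simp add: kre_def emb_diff)

lemma kre_sum: "kre (sum f A) = (\<Sum>a\<in>A. kre (f a))"
  by (simp add: kre_def emb_sum)

lemma kre_scale: "kre (of_real r * z) = r * kre z"
  by (simp add: kre_def emb_mult)

lemma kre_kcnj_mult_self: "kre (kcnj z * z) = (norm z)\<^sup>2"
proof -
  have "Re (cnj w * w) = (cmod w)\<^sup>2" for w
    using cmod_power2[of w] by (simp add: power2_eq_square)
  thus ?thesis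
    by (simp add: kre_def emb_mult norm_emb)
qed

lemma norm_add_sq: "(norm (a + b))\<^sup>2 = (norm a)\<^sup>2 + 2 * kre (kcnj a * b) + (norm b)\<^sup>2"
proof -
  have *: "(cmod (z + w))\<^sup>2 = (cmod z)\<^sup>2 + 2 * Re (cnj z * w) + (cmod w)\<^sup>2" for z w
    unfolding cmod_power2 by (simp add: power2_eq_square algebra_simps)
  show ?thesis
    using *[of "emb a" "emb b"] by (simp add: kre_def emb_mult norm_emb flip: emb_add)
qed

text \<open>A real part that reaches the bound on the modulus leaves no room for an imaginary part.
  This upgrades a statement on the real part of a functional to its full value.\<close>

lemma kre_eq_norm_imp:
  assumes "kre z = r" "norm z \<le> r"
  shows "z = of_real r"
proof -
  have "Re (emb z) = r" "cmod (emb z) \<le> r"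
    using assms by (auto simp: kre_def norm_emb)
  hence "emb z = of_real r"
    using cmod_power2[of "emb z"] power_mono[of "cmod (emb z)" r 2]
    by (auto simp: complex_eq_iff)
  hence "emb z = emb (of_real r :: 'a)"
    by simp
  thus ?thesis
    using inj_emb by (meson injD)
qed

lemma ex_unimodular:
  obtains u :: "'k::real_or_complex" where "norm u = 1" "u * z = of_real (norm z)"
proof (cases "z = 0")
  case True
  thus ?thesis
    using that[of 1] by simp
next
  case False
  thus ?thesis
    using that[of "of_real (norm z) / z"] by (simp add: norm_divide)
qed

text \<open>In the complex case \<open>j\<close> is the preimage of the imaginary unit, and
  \<open>kre (j * k)\<close> is minus the imaginary part of \<open>k\<close>, which explains the
  sign.\<close>

lemma scalar_cases:
  obtains (real) "\<And>k :: 'k::real_or_complex. k = of_real (kre k)"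
  | (complex) j :: "'k::real_or_complex" where
      "j * j = -1" "kre j = 0" "\<And>k. k = of_real (kre k) - j * of_real (kre (j * k))"
proof -
  show ?thesis
  proof (cases "range (emb :: 'k \<Rightarrow> complex) = UNIV")
    case True
    then obtain j :: 'k where j: "emb j = \<i>"
      by (metis surj_def)
    have "emb (j * j) = emb (-1 :: 'k)"
      using emb_of_real[of "-1", where 'a='k] by (simp add: emb_mult j)
    hence "j * j = -1"
      using inj_emb by (meson injD)
    moreover have "k = of_real (kre k) - j * of_real (kre (j * k))" for k
    proof -
      have "emb k = emb (of_real (kre k) - j * of_real (kre (j * k)))"
        by (simp add: emb_diff emb_add emb_mult j kre_def complex_eq_iff)
      thus ?thesis
        using inj_emb by (meson injD)
    qed
    moreover have "kre j = 0"
      by (simp add: kre_def j)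
    ultimately show ?thesis
      using complex by blast
  next
    case False
    hence R: "range (emb :: 'k \<Rightarrow> complex) = \<real>"
      using range_emb by blast
    have "k = of_real (kre k)" for k :: 'k
    proof -
      have "emb k = emb (of_real (kre k) :: 'k)"
        using R by (simp add: kre_def) (metis of_real_Re rangeI)
      thus ?thesis
        using inj_emb by (meson injD)
    qed
    thus ?thesis
      using real by blast
  qed
qed

section \<open>A Hahn--Banach theorem for sublinear functionals\<close>

definition sublinear :: "('a::real_vector \<Rightarrow> real) \<Rightarrow> bool" where
  "sublinear p \<longleftrightarrow> (\<forall>x y. p (x + y) \<le> p x + p y) \<and> (\<forall>t\<ge>0. \<forall>x. p (t *\<^sub>R x) = t * p x)"

lemma sublinear_add: "sublinear p \<Longrightarrow> p (x + y) \<le> p x + p y"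
  and sublinear_scale: "sublinear p \<Longrightarrow> t \<ge> 0 \<Longrightarrow> p (t *\<^sub>R x) = t * p x"
  by (auto simp: sublinear_def)

lemma sublinear_0: "sublinear p \<Longrightarrow> p 0 = 0"
  using sublinear_scale[of p 0 0] by simp

lemma sublinear_minus: "sublinear p \<Longrightarrow> - p (- x) \<le> p x"
  using sublinear_add[of p x "- x"] sublinear_0[of p] by simp

text \<open>When \<open>h \<le> p\<close> is additive and positively homogeneous on the convex cone \<open>M\<close>, every linear
  functional below \<open>lower_env p M h\<close> is at most \<open>p\<close> everywhere and at least \<open>h\<close> on \<open>M\<close>.\<close>

definition lower_env :: "('a::real_vector \<Rightarrow> real) \<Rightarrow> 'a set \<Rightarrow> ('a \<Rightarrow> real) \<Rightarrow> 'a \<Rightarrow> real" where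
  "lower_env p M h v = (INF z\<in>M. p (v + z) - h z)"

context
  fixes p h :: "'a::real_vector \<Rightarrow> real" and M :: "'a set"
  assumes p: "sublinear p"
    and zero: "0 \<in> M" "h 0 = 0"
    and add: "\<And>x y. x \<in> M \<Longrightarrow> y \<in> M \<Longrightarrow> x + y \<in> M \<and> h (x + y) = h x + h y"
    and scale: "\<And>t x. t > 0 \<Longrightarrow> x \<in> M \<Longrightarrow> t *\<^sub>R x \<in> M \<and> h (t *\<^sub>R x) = t * h x"
    and le: "\<And>x. x \<in> M \<Longrightarrow> h x \<le> p x"
begin

lemma lower_env_lower:
  assumes "z \<in> M"
  shows "lower_env p M h v \<le> p (v + z) - h z"
  unfolding lower_env_def
proof (rule cINF_lower[OF _ assms])
  have "- p (- v) \<le> p (v + z) - h z" if "z \<in> M" for z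
    using sublinear_add[OF p, of "v + z" "- v"] le[OF that] by simp
  thus "bdd_below ((\<lambda>z. p (v + z) - h z) ` M)"
    by (auto intro!: bdd_belowI2)
qed

lemma lower_env_greatest:
  assumes "\<And>z. z \<in> M \<Longrightarrow> c \<le> p (v + z) - h z"
  shows "c \<le> lower_env p M h v"
  unfolding lower_env_def using assms zero by (intro cINF_greatest) auto

lemma lower_env_le: "lower_env p M h v \<le> p v"
  using lower_env_lower[OF zero(1), of v] zero by simp

lemma lower_env_uminus: "z \<in> M \<Longrightarrow> lower_env p M h (- z) \<le> - h z"
  using lower_env_lower[of z "- z"] sublinear_0[OF p] by simp

lemma sublinear_lower_env: "sublinear (lower_env p M h)"
proof -
  let ?q = "lower_env p M h"
  have sub: "?q (v + w) \<le> ?q v + ?q w" for v w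
  proof -
    have "?q (v + w) - (p (v + z) - h z) \<le> ?q w" if z: "z \<in> M" for z
    proof (rule lower_env_greatest)
      fix z' assume z': "z' \<in> M"
      show "?q (v + w) - (p (v + z) - h z) \<le> p (w + z') - h z'"
        using lower_env_lower[of "z + z'" "v + w"] add[OF z z']
          sublinear_add[OF p, of "v + z" "w + z'"] by (simp add: algebra_simps)
    qed
    hence "?q (v + w) - ?q w \<le> ?q v"
      by (intro lower_env_greatest) (simp add: algebra_simps)
    thus ?thesis
      by simp
  qed
  have le': "?q (t *\<^sub>R v) \<le> t * ?q v" if t: "t > 0" for t v
  proof -
    have "?q (t *\<^sub>R v) / t \<le> ?q v"
    proof (rule lower_env_greatest)
      fix z assume z: "z \<in> M"
      have "?q (t *\<^sub>R v) \<le> p (t *\<^sub>R (v + z)) - h (t *\<^sub>R z)"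
        using lower_env_lower[of "t *\<^sub>R z" "t *\<^sub>R v"] scale[OF t z] by (simp add: scaleR_add_right)
      also have "\<dots> = t * (p (v + z) - h z)"
        using scale[OF t z] sublinear_scale[OF p, of t "v + z"] t by (simp add: right_diff_distrib)
      finally show "?q (t *\<^sub>R v) / t \<le> p (v + z) - h z"
        using t by (simp add: field_simps)
    qed
    thus ?thesis
      using t by (simp add: field_simps)
  qed
  have "?q (t *\<^sub>R v) = t * ?q v" if "t \<ge> 0" for t v
  proof (cases "t = 0")
    case True
    have "?q 0 \<le> 0"
      using lower_env_le[of 0] sublinear_0[OF p] by simp
    moreover have "0 \<le> ?q 0"
      using sub[of 0 0] by simp
    ultimately show ?thesis
      using True by simp
  next
    case False
    hence t: "t > 0"
      using that by simp
    have "?q ((1 / t) *\<^sub>R (t *\<^sub>R v)) \<le> (1 / t) * ?q (t *\<^sub>R v)"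
      using t by (intro le') simp
    with le'[OF t, of v] t show ?thesis
      by (simp add: field_simps)
  qed
  with sub show ?thesis
    by (simp add: sublinear_def)
qed

end

text \<open>On the ray through \<open>z\<close> the functional \<open>p\<close> is itself additive,
  so it can serve as the minorant \<open>h\<close> of its own envelope. The gain
  \<open>q (- z) \<le> - p z\<close> is what oddness requires.\<close>

lemma sublinear_lower_along_ray:
  assumes p: "sublinear p"
  obtains q where "sublinear q" "\<And>v. q v \<le> p v" "q (- z) \<le> - p z"
proof -
  let ?M = "(\<lambda>t. t *\<^sub>R z) ` {0..}"
  have M: "sublinear p" "0 \<in> ?M" "p 0 = 0"
    "\<And>x y. x \<in> ?M \<Longrightarrow> y \<in> ?M \<Longrightarrow> x + y \<in> ?M \<and> p (x + y) = p x + p y"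
    "\<And>t x. t > 0 \<Longrightarrow> x \<in> ?M \<Longrightarrow> t *\<^sub>R x \<in> ?M \<and> p (t *\<^sub>R x) = t * p x"
    "\<And>x. x \<in> ?M \<Longrightarrow> p x \<le> p x"
    by (auto simp: p sublinear_0 sublinear_scale image_iff algebra_simps
        simp flip: scaleR_add_left intro: bexI[of _ 0] bexI[of _ "_ + _"] bexI[of _ "_ * _"])
  have "z \<in> ?M"
    by (auto simp: image_iff intro: bexI[of _ 1])
  thus thesis
    using that[OF sublinear_lower_env[OF M] lower_env_le[OF M]] lower_env_uminus[OF M] by blast
qed

text \<open>A minimal sublinear functional cannot be lowered along any ray, which forces it to be odd and
  hence linear.\<close>

lemma linear_of_minimal_sublinear:
  assumes r: "sublinear r" and min: "\<And>s. sublinear s \<Longrightarrow> (\<And>v. s v \<le> r v) \<Longrightarrow> s = r"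
  shows "linear r"
proof -
  have odd: "r (- z) = - r z" for z
  proof -
    obtain q where "sublinear q" "\<And>v. q v \<le> r v" "q (- z) \<le> - r z"
      using sublinear_lower_along_ray[OF r, of z] by blast
    moreover from this have "q = r"
      by (intro min)
    ultimately have "r (- z) \<le> - r z"
      by simp
    thus ?thesis
      using sublinear_minus[OF r, of z] by simp
  qed
  show ?thesis
  proof (rule linearI)
    fix x y
    show "r (x + y) = r x + r y"
      using sublinear_add[OF r, of x y] sublinear_add[OF r, of "- x" "- y"] odd[of "x + y"]
      by (simp add: odd)
  next
    fix t x
    show "r (t *\<^sub>R x) = t *\<^sub>R r x"
      using sublinear_scale[OF r, of t x] sublinear_scale[OF r, of "- t" x] odd[of "t *\<^sub>R x"]
      by (cases "t \<ge> 0") auto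
  qed
qed

text \<open>Zorn's lemma yields a minimal sublinear functional below a given one, and minimality
  makes it linear. To get equality at \<open>x\<close>, this is applied not to \<open>p\<close> but
  to its envelope along the ray of \<open>x\<close>.\<close>

theorem Hahn_Banach_sublinear:
  assumes p: "sublinear p"
  obtains f where "linear f" "\<And>v. f v \<le> p v" "f x = p x"
proof -
  have ex: "\<exists>f. linear f \<and> (\<forall>v. f v \<le> q v)" if q: "sublinear q" for q :: "'a \<Rightarrow> real"
  proof -
    define A where "A = {s. sublinear s \<and> s \<le> q}"
    have "\<exists>m\<in>A. \<forall>a\<in>A. m \<ge> a \<longrightarrow> a = m"
    proof (rule predicate_Zorn)
      show "partial_order_on A (relation_of (\<ge>) A)"
        by (rule partial_order_on_relation_ofI) auto
      fix C assume C: "C \<in> Chains (relation_of (\<ge>) A)"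
      hence CA: "C \<subseteq> A" and tot: "\<And>a b. a \<in> C \<Longrightarrow> b \<in> C \<Longrightarrow> a \<le> b \<or> b \<le> a"
        by (auto simp: Chains_def relation_of_def)
      show "\<exists>u\<in>A. \<forall>a\<in>C. u \<le> a"
      proof (cases "C = {}")
        case True
        thus ?thesis
          using q by (auto simp: A_def)
      next
        case False
        define u where "u v = (INF s\<in>C. s v)" for v
        have C': "sublinear s" "s v \<le> q v" if "s \<in> C" for s v
          using CA that by (auto simp: A_def le_fun_def)
        have bdd: "bdd_below ((\<lambda>s. s v) ` C)" for v
        proof (rule bdd_belowI2)
          fix s assume "s \<in> C"
          thus "- q (- v) \<le> s v"
            using C'(2)[of s "- v"] sublinear_minus[OF C'(1), of s v] by simp
        qed
        have lower: "u v \<le> s v" if "s \<in> C" for s v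
          unfolding u_def using bdd that by (intro cINF_lower)
        have greatest: "c \<le> u v" if "\<And>s. s \<in> C \<Longrightarrow> c \<le> s v" for c v
          unfolding u_def using False that by (intro cINF_greatest)
        have "u (v + w) \<le> u v + u w" for v w
        proof -
          have "u (v + w) - s v \<le> u w" if s: "s \<in> C" for s
          proof (rule greatest)
            fix s' assume s': "s' \<in> C"
            \<comment> \<open>In a chain the smaller of the two functionals bounds both terms at
              once.\<close>
            obtain r where "r \<in> C" "r \<le> s" "r \<le> s'"
              using tot[OF s s'] s s' by blast
            hence "u (v + w) \<le> r v + r w" "r v \<le> s v" "r w \<le> s' w"
              using lower[of r "v + w"] sublinear_add[OF C'(1), of r v w] by (auto simp: le_fun_def)
            thus "u (v + w) - s v \<le> s' w"
              by simp
          qed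
          hence "u (v + w) - u w \<le> u v"
            by (intro greatest) (simp add: algebra_simps)
          thus ?thesis
            by simp
        qed
        moreover have "u (t *\<^sub>R v) = t * u v" if t: "t \<ge> 0" for t v
        proof (cases "t = 0")
          case True
          have "u 0 = (INF s\<in>C. 0)"
            unfolding u_def using C' by (intro INF_cong) (auto simp: sublinear_0)
          thus ?thesis
            using True False by simp
        next
          case False
          hence t: "t > 0"
            using t by simp
          have "t * u v \<le> u (t *\<^sub>R v)"
            using t lower[of _ v] by (intro greatest) (simp add: sublinear_scale C')
          moreover have "u (t *\<^sub>R v) / t \<le> u v"
            using t lower[of _ "t *\<^sub>R v"] by (intro greatest) (simp add: sublinear_scale C' field_simps)
          ultimately show ?thesis
            using t by (simp add: field_simps)
        qed
        ultimately have "sublinear u"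
          by (simp add: sublinear_def)
        moreover have "u \<le> q"
          using False by (auto simp: le_fun_def intro: order_trans[OF lower C'(2)])
        ultimately show ?thesis
          using lower by (auto simp: A_def le_fun_def)
      qed
    qed
    then obtain m where m: "sublinear m" "m \<le> q" "\<And>a. sublinear a \<Longrightarrow> a \<le> m \<Longrightarrow> a = m"
      unfolding A_def by (smt (verit) mem_Collect_eq order_trans)
    have "linear m"
      using m by (intro linear_of_minimal_sublinear) (auto simp: le_fun_def)
    with m show ?thesis
      by (auto simp: le_fun_def)
  qed
  obtain q where q: "sublinear q" "\<And>v. q v \<le> p v" "q (- x) \<le> - p x"
    using sublinear_lower_along_ray[OF p, of x] by blast
  obtain f where f: "linear f" "\<And>v. f v \<le> q v"
    using ex[OF q(1)] by blast
  have fp: "f v \<le> p v" for v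
    using f(2)[of v] q(2)[of v] by simp
  have "f (- x) \<le> - p x"
    using f(2)[of "- x"] q(3) by simp
  hence "f x = p x"
    using fp[of x] linear_neg[OF f(1), of x] by simp
  with f(1) fp that show thesis
    by blast
qed

section \<open>Finite-dimensional normed spaces\<close>

text \<open>A convergent sequence is bounded, so it stays in one of the compact pieces. In the
  induction for \<open>compact_cball_span\<close> this turns the hypothesis into closedness.\<close>

lemma closed_of_compact_balls:
  fixes S :: "'a::real_normed_vector set"
  assumes "\<And>R. compact (cball 0 R \<inter> S)"
  shows "closed S"
  unfolding closed_sequential_limits
proof (intro allI impI, elim conjE)
  fix X l assume X: "\<forall>n. X n \<in> S" "X \<longlonglongrightarrow> l"
  obtain R where "\<And>n. norm (X n) \<le> R"
    using convergent_imp_Bseq[OF convergentI[OF X(2)]] by (metis BseqE)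
  hence "X n \<in> cball 0 R \<inter> S" for n
    using X(1) by auto
  with compact_imp_closed[OF assms, of R] X(2) have "l \<in> cball 0 R \<inter> S"
    by (meson closed_sequentially)
  thus "l \<in> S"
    by simp
qed

context normed_space_over
begin

lemma bounded_linear_smul_left: "bounded_linear (\<lambda>t. smul t b)"
proof (rule bounded_linear_intro[where K = "norm b"])
  show "smul (r *\<^sub>R t) b = r *\<^sub>R smul t b" for r t
    by (metis scaleR_conv_of_real scale_of_real scale_scale)
qed (simp_all add: scale_left_distrib norm_scale)

text \<open>A ball around \<open>b\<close> that misses \<open>T\<close> has radius at most the
  distance of \<open>b\<close> from \<open>T\<close>; scaling by \<open>c\<close> gives the
  estimate. The coefficient of \<open>b\<close> along \<open>T\<close> is thus controlled by the
  norm of the vector.\<close>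

lemma line_complement_bound:
  assumes "closed T" "subspace T" "b \<notin> T"
  obtains d where "d > 0" "\<And>c s. s \<in> T \<Longrightarrow> d * norm c \<le> norm (smul c b + s)"
proof -
  obtain d where d: "d > 0" "ball b d \<subseteq> - T"
    using assms(1,3) by (meson ComplI openE open_Compl)
  have "d * norm c \<le> norm (smul c b + s)" if s: "s \<in> T" for c s
  proof (cases "c = 0")
    case False
    let ?s = "smul (- inverse c) s"
    have "?s \<in> T"
      using s assms(2) by (intro subspace_scale)
    hence "?s \<notin> ball b d"
      using d(2) by blast
    hence "d \<le> norm (b - ?s)"
      by (simp only: mem_ball dist_norm not_less)
    hence "norm c * d \<le> norm c * norm (b - ?s)"
      by (intro mult_left_mono) auto
    also have "\<dots> = norm (smul c b + s)"
      using False by (simp flip: norm_scale add: scale_right_distrib)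
    finally show ?thesis
      by (simp add: mult.commute)
  qed simp
  with d(1) that show thesis
    by blast
qed

text \<open>Induction on the spanning set: the coefficient of a new independent vector is at most
  \<open>R / d\<close>, the rest is bounded by the triangle inequality, and so the ball lies in a
  continuous image of a product of two compact sets.\<close>

lemma compact_cball_span:
  assumes "finite B"
  shows "compact (cball 0 R \<inter> span B)"
  using assms
proof (induction B arbitrary: R)
  case empty
  show ?case
    by (intro finite_imp_compact) simp
next
  case (insert b B)
  show ?case
  proof (cases "b \<in> span B")
    case True
    thus ?thesis
      by (simp add: span_redundant insert.IH)
  next
    case False
    have "closed (span B)"
      by (intro closed_of_compact_balls insert.IH)
    then obtain d where d: "d > 0" "\<And>c s. s \<in> span B \<Longrightarrow> d * norm c \<le> norm (smul c b + s)"
      using line_complement_bound[OF _ subspace_span False] by blast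
    let ?f = "\<lambda>(t, s). smul t b + s"
    let ?K = "cball 0 (R / d) \<times> (cball 0 (R + R / d * norm b) \<inter> span B)"
    have "continuous_on ?K ?f"
      unfolding split_def
      by (intro continuous_intros bounded_linear.continuous_on[OF bounded_linear_smul_left])
    hence "compact (cball 0 R \<inter> ?f ` ?K)"
      by (intro closed_Int_compact compact_continuous_image compact_Times compact_cball_scalar
          insert.IH closed_cball)
    also have "cball 0 R \<inter> ?f ` ?K = cball 0 R \<inter> span (insert b B)"
    proof (intro equalityI subsetI)
      fix x assume x: "x \<in> cball 0 R \<inter> span (insert b B)"
      then obtain t where t: "x - smul t b \<in> span B"
        by (auto simp: span_breakdown_eq)
      have "d * norm t \<le> norm x"
        using d(2)[OF t, of t] by simp
      hence nt: "norm t \<le> R / d"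
        using x d(1) by (simp add: field_simps)
      have "norm (x - smul t b) \<le> norm x + norm t * norm b"
        by (metis norm_scale norm_triangle_ineq4)
      also have "\<dots> \<le> R + R / d * norm b"
        using x nt by (intro add_mono mult_right_mono) auto
      finally have "(t, x - smul t b) \<in> ?K"
        using t nt by simp
      moreover have "x = ?f (t, x - smul t b)"
        by simp
      ultimately show "x \<in> cball 0 R \<inter> ?f ` ?K"
        using x by blast
    next
      fix x assume "x \<in> cball 0 R \<inter> ?f ` ?K"
      thus "x \<in> cball 0 R \<inter> span (insert b B)"
        by (auto intro!: span_add span_scale intro: span_base span_mono[THEN subsetD, rotated])
    qed
    finally show ?thesis .
  qed
qed

lemma closed_span_finite: "finite B \<Longrightarrow> closed (span B)"
  by (intro closed_of_compact_balls compact_cball_span)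

lemma representation_bound:
  assumes B: "finite B" "independent B" and b: "b \<in> B"
  obtains d where "d > 0" "\<And>x. x \<in> span B \<Longrightarrow> d * norm (representation B x b) \<le> norm x"
proof -
  have "b \<notin> span (B - {b})"
    using B b by (auto simp: dependent_def)
  then obtain d where d: "d > 0"
    "\<And>c s. s \<in> span (B - {b}) \<Longrightarrow> d * norm c \<le> norm (smul c b + s)"
    using line_complement_bound[OF closed_span_finite subspace_span] B(1) by blast
  have "d * norm (representation B x b) \<le> norm x" if x: "x \<in> span B" for x
  proof -
    let ?s = "\<Sum>a\<in>B - {b}. smul (representation B x a) a"
    have "x = smul (representation B x b) b + ?s"
      using sum_representation_eq[OF B(2) x B(1) subset_refl] B(1) b by (simp add: sum.remove)
    moreover have "?s \<in> span (B - {b})"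
      by (intro span_sum span_scale span_base)
    ultimately show ?thesis
      using d(2) by metis
  qed
  with d(1) that show thesis
    by blast
qed

lemma continuous_on_representation:
  assumes B: "finite B" "independent B"
  shows "continuous_on (span B) (\<lambda>x. representation B x b)"
proof (cases "b \<in> B")
  case True
  obtain d where d: "d > 0" "\<And>x. x \<in> span B \<Longrightarrow> d * norm (representation B x b) \<le> norm x"
    using representation_bound[OF B True] by blast
  show ?thesis
    unfolding continuous_on_iff
  proof (intro ballI allI impI)
    fix x and e :: real assume x: "x \<in> span B" and e: "e > 0"
    have "dist (representation B y b) (representation B x b) < e"
      if y: "y \<in> span B" "dist y x < d * e" for y
    proof -
      have "d * norm (representation B (y - x) b) \<le> norm (y - x)"
        using x y by (intro d span_diff)
      also have "\<dots> < d * e"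
        using y by (simp add: dist_norm)
      finally show ?thesis
        using d(1) x y B(2) by (simp add: dist_norm representation_diff)
    qed
    thus "\<exists>\<delta>>0. \<forall>y\<in>span B. dist y x < \<delta> \<longrightarrow>
        dist (representation B y b) (representation B x b) < e"
      using d(1) e by (intro exI[of _ "d * e"]) auto
  qed
next
  case False
  hence "representation B x b = 0" for x
    using representation_ne_zero by blast
  thus ?thesis
    by simp
qed

lemma finite_dim_basis:
  assumes "finite_dim smul"
  obtains B where "finite B" "independent B" "span B = UNIV"
  using assms unfolding finite_dim_def
  by (metis finite_subset maximal_independent_subset span_eq_iff span_mono span_span
      subspace_UNIV top.extremum_uniqueI)

section \<open>Elementary facts on Birkhoff-James orthogonality\<close>

lemma bj_zero_left [simp]: "bj_orthogonal smul 0 y"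
  by (simp add: bj_orthogonal_def)

lemma bj_zero_right [simp]: "bj_orthogonal smul x 0"
  by (simp add: bj_orthogonal_def)

lemma bj_self [simp]: "bj_orthogonal smul x x \<longleftrightarrow> x = 0"
proof
  assume "bj_orthogonal smul x x"
  hence "norm (x + smul (- 1) x) \<ge> norm x"
    unfolding bj_orthogonal_def by blast
  thus "x = 0"
    by simp
qed simp

lemma bj_scale_right:
  assumes "bj_orthogonal smul x y"
  shows "bj_orthogonal smul x (smul c y)"
  using assms by (simp add: bj_orthogonal_def)

lemma bj_scale_left:
  assumes "bj_orthogonal smul x y"
  shows "bj_orthogonal smul (smul c x) y"
proof (cases "c = 0")
  case False
  show ?thesis
    unfolding bj_orthogonal_def
  proof
    fix l
    have "norm c * norm x \<le> norm c * norm (x + smul (l / c) y)"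
      using assms by (intro mult_left_mono) (auto simp: bj_orthogonal_def)
    thus "norm (smul c x) \<le> norm (smul c x + smul l y)"
      using False by (simp add: scale_right_distrib flip: norm_scale)
  qed
qed simp


section \<open>Orthogonality and linear functionals\<close>

abbreviation linear_functional :: "('a \<Rightarrow> 'k) \<Rightarrow> bool" where
  "linear_functional \<equiv> Vector_Spaces.linear smul (*)"

lemma linear_functionalI:
  assumes "\<And>x y. f (x + y) = f x + f y" "\<And>c x. f (smul c x) = c * f x"
  shows "linear_functional f"
  unfolding Vector_Spaces.linear_iff
  using assms vector_space_axioms vector_space_over_itself.vector_space_axioms by blast

lemma linear_functional_add: "linear_functional f \<Longrightarrow> f (x + y) = f x + f y"
  and linear_functional_scale: "linear_functional f \<Longrightarrow> f (smul c x) = c * f x"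
  by (auto simp: Vector_Spaces.linear_iff)

lemma linear_functional_0: "linear_functional f \<Longrightarrow> f 0 = 0"
  using linear_functional_scale[of f 0 0] by simp

lemma linear_functional_diff: "linear_functional f \<Longrightarrow> f (x - y) = f x - f y"
  using linear_functional_add[of f "x - y" y] by simp

lemma subspace_kernel: "linear_functional f \<Longrightarrow> subspace {x. f x = 0}"
  by (intro subspaceI)
    (auto simp: linear_functional_0 linear_functional_add linear_functional_scale)

lemma subspace_kernels:
  "(\<And>i. i \<in> J \<Longrightarrow> linear_functional (f i)) \<Longrightarrow> subspace (\<Inter>i\<in>J. {x. f i x = 0})"
  by (rule subspace_Inter) (auto intro: subspace_kernel)

lemma scaleR_smul: "r *\<^sub>R x = smul (of_real r) x"
  by (simp add: scale_of_real)

lemma real_linear_smul_of_real: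
  "linear f \<Longrightarrow> f (smul (of_real r) v) = r * (f v :: real)"
  by (simp add: scale_of_real linear_scale)

text \<open>In the complex case linearity forces the imaginary part of \<open>F v\<close>: it must
  be minus \<open>f\<close> at \<open>smul j v\<close>. This reduces Hahn-Banach over either field
  to the real version.\<close>

lemma ex_linear_functional_re:
  fixes f :: "'a \<Rightarrow> real"
  assumes f: "linear f"
  obtains F where "linear_functional F" "\<And>v. kre (F v) = f v"
proof (cases rule: scalar_cases[where 'k='k])
  case real
  have "linear_functional (\<lambda>v. of_real (f v))"
  proof (rule linear_functionalI)
    show "of_real (f (smul c x)) = c * of_real (f x)" for c x
      using real_linear_smul_of_real[OF f, of "kre c" x] real[of c] by (metis of_real_mult)
  qed (simp add: linear_add[OF f])
  thus thesis
    by (intro that[of "\<lambda>v. of_real (f v)"]) simp_all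
next
  case (complex j)
  let ?F = "\<lambda>v. of_real (f v) - j * of_real (f (smul j v))"
  have "linear_functional ?F"
  proof (rule linear_functionalI)
    show "?F (x + y) = ?F x + ?F y" for x y
      by (simp add: scale_right_distrib linear_add[OF f] algebra_simps)
    fix c x
    define a b where "a = kre c" and "b = kre (j * c)"
    have c: "c = of_real a - j * of_real b"
      using complex(3) by (simp add: a_def b_def)
    have jc: "j * c = of_real a * j + of_real b"
      using complex(1) by (simp add: c algebra_simps flip: mult.assoc)
    have "f (smul c x) = f (smul (of_real a) x - smul (of_real b) (smul j x))"
      by (simp add: c scale_left_diff_distrib mult.commute)
    hence 1: "f (smul c x) = a * f x - b * f (smul j x)"
      by (simp add: linear_diff[OF f] real_linear_smul_of_real[OF f] del: scale_scale)
    have "f (smul j (smul c x)) = f (smul (of_real a) (smul j x) + smul (of_real b) x)"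
      by (simp add: jc scale_left_distrib)
    hence 2: "f (smul j (smul c x)) = a * f (smul j x) + b * f x"
      by (simp add: linear_add[OF f] real_linear_smul_of_real[OF f] del: scale_scale)
    have jj: "j * (j * z) = - z" for z
      using complex(1) by (simp flip: mult.assoc)
    show "?F (smul c x) = c * ?F x"
      unfolding 1 2 by (simp add: c algebra_simps jj)
  qed
  moreover have "kre (?F v) = f v" for v
    using kre_scale[of "f (smul j v)" j] complex(2) by (simp add: kre_diff mult.commute)
  ultimately show thesis
    by (intro that) auto
qed

lemma bounded_linear_functional:
  assumes f: "linear_functional f" and le: "\<And>v. norm (f v) \<le> norm v"
  shows "bounded_linear f"
proof (rule bounded_linear_intro[where K = 1])
  show "f (r *\<^sub>R v) = r *\<^sub>R f v" for r v
    using linear_functional_scale[OF f, of "of_real r" v] by (simp add: scale_of_real scaleR_conv_of_real)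
qed (use le linear_functional_add[OF f] in auto)

text \<open>The envelope of the norm along the multiples of \<open>y\<close> is the distance to that
  line. Orthogonality says that at \<open>x\<close> this distance is \<open>norm x\<close>, so a
  functional touching the envelope at \<open>x\<close> supports \<open>x\<close>; being at most 0 on
  all multiples of \<open>y\<close>, it vanishes at \<open>y\<close>.\<close>

lemma bj_imp_supporting_functional:
  assumes x: "x \<noteq> 0" and bj: "bj_orthogonal smul x y"
  obtains f where "supporting_functional smul x f" "f y = 0"
proof -
  let ?M = "range (\<lambda>l. smul l y)" and ?h = "\<lambda>_. 0 :: real"
  have M: "sublinear norm" "0 \<in> ?M" "?h 0 = 0"
    "\<And>u v. u \<in> ?M \<Longrightarrow> v \<in> ?M \<Longrightarrow> u + v \<in> ?M \<and> ?h (u + v) = ?h u + ?h v"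
    "\<And>t u. t > 0 \<Longrightarrow> u \<in> ?M \<Longrightarrow> t *\<^sub>R u \<in> ?M \<and> ?h (t *\<^sub>R u) = t * ?h u"
    "\<And>u. u \<in> ?M \<Longrightarrow> ?h u \<le> norm u"
    by (auto simp: sublinear_def norm_triangle_ineq image_iff scaleR_smul norm_scale
        simp flip: scale_left_distrib intro: exI[of _ 0] exI[of _ "_ + _"] exI[of _ "_ * _"])
  let ?p = "lower_env norm ?M ?h"
  obtain f where f: "linear f" "\<And>v. f v \<le> ?p v" "f x = ?p x"
    using Hahn_Banach_sublinear[OF sublinear_lower_env[OF M]] by blast
  have le: "f v \<le> norm v" for v
    using f(2)[of v] lower_env_le[OF M, of v] by simp
  have "norm x \<le> ?p x"
    using bj by (intro lower_env_greatest[OF M]) (auto simp: bj_orthogonal_def)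
  hence fx: "f x = norm x"
    using f(3) le[of x] by simp
  have fy: "f (smul l y) \<le> 0" for l
    using f(2)[of "smul l y"] lower_env_uminus[OF M rangeI[of _ "- l"]] by simp
  obtain F where F: "linear_functional F" "\<And>v. kre (F v) = f v"
    using ex_linear_functional_re[OF f(1)] by blast
  \<comment> \<open>A unimodular factor rotates \<open>F v\<close> onto the nonnegative reals and so
    turns bounds on the real part \<open>f\<close> into bounds on the modulus.\<close>
  have F_norm: "\<exists>u. norm u = 1 \<and> norm (F v) = f (smul u v)" for v
  proof -
    obtain u where u: "norm u = 1" "u * F v = of_real (norm (F v))"
      by (rule ex_unimodular)
    have "f (smul u v) = norm (F v)"
      using F(2)[of "smul u v"] by (simp add: linear_functional_scale[OF F(1)] u)
    with u show ?thesis
      by auto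
  qed
  have F_le: "norm (F v) \<le> norm v" for v
    using F_norm[of v] le by (metis mult_1 norm_scale)
  have Fx: "F x = of_real (norm x)"
    using F_le[of x] by (intro kre_eq_norm_imp) (simp_all add: F(2) fx)
  have "F y = 0"
    using F_norm[of y] fy by (metis norm_le_zero_iff)
  moreover have bl: "bounded_linear F"
    by (rule bounded_linear_functional[OF F(1) F_le])
  moreover have "onorm F = 1"
  proof (rule antisym)
    show "onorm F \<le> 1"
      using F_le by (intro onorm_bound) auto
    show "onorm F \<ge> 1"
      using onorm[OF bl, of x] x by (simp add: Fx)
  qed
  ultimately show thesis
    using F(1) Fx by (intro that[of F]) (auto simp: supporting_functional_def)
qed

lemma supporting_functional_imp_bj:
  assumes f: "supporting_functional smul x f" and y: "f y = 0"
  shows "bj_orthogonal smul x y"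
  unfolding bj_orthogonal_def
proof
  fix l
  have lin: "linear_functional f" and "bounded_linear f" "onorm f = 1" "f x = of_real (norm x)"
    using f by (auto simp: supporting_functional_def)
  hence "norm (f (x + smul l y)) \<le> norm (x + smul l y)"
    using onorm[of f "x + smul l y"] by simp
  moreover have "f (x + smul l y) = of_real (norm x)"
    using y \<open>f x = _\<close> by (simp add: linear_functional_add[OF lin] linear_functional_scale[OF lin])
  ultimately show "norm x \<le> norm (x + smul l y)"
    by simp
qed

text \<open>Every \<open>y\<close> orthogonal to \<open>x\<close> is annihilated by some supporting
  functional at \<open>x\<close>, and smoothness leaves only one. For \<open>x = 0\<close> the zero
  functional serves.\<close>

lemma smooth_bj_iff_kernel:
  assumes "smooth_space smul"
  obtains f where "linear_functional f" "\<And>y. bj_orthogonal smul x y \<longleftrightarrow> f y = 0"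
proof (cases "x = 0")
  case True
  thus ?thesis
    by (intro that[of "\<lambda>_. 0"]) (simp_all add: linear_functionalI)
next
  case False
  then obtain f where f: "supporting_functional smul x f"
    "\<And>g. supporting_functional smul x g \<Longrightarrow> g = f"
    using assms unfolding smooth_space_def smooth_point_def by metis
  show ?thesis
  proof (rule that[of f])
    show "linear_functional f"
      using f(1) by (simp add: supporting_functional_def)
    show "bj_orthogonal smul x y \<longleftrightarrow> f y = 0" for y
      using f bj_imp_supporting_functional[OF False, of y] supporting_functional_imp_bj by metis
  qed
qed

text \<open>Without smoothness only this inclusion is available. For nonzero \<open>x\<close> the
  functional comes from the trivial orthogonality of \<open>x\<close> to 0.\<close>

lemma ex_kernel_subset_bj:
  obtains f where "linear_functional f" "\<And>y. f y = 0 \<Longrightarrow> bj_orthogonal smul x y"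
proof (cases "x = 0")
  case True
  thus ?thesis
    by (intro that[of "\<lambda>_. 0"]) (simp_all add: linear_functionalI)
next
  case False
  then obtain f where "supporting_functional smul x f"
    using bj_imp_supporting_functional[of x 0] by auto
  thus ?thesis
    using that[of f] supporting_functional_imp_bj by (auto simp: supporting_functional_def)
qed

text \<open>With \<open>q\<close> the weighted sum of squared coordinates, \<open>x\<close> is a point where the unit sphere touches
  the inscribed ellipsoid \<open>q \<le> q x\<close>. Orthogonality to \<open>y\<close> keeps the line \<open>x + ly\<close> outside the
  open unit ball, hence outside the interior of the ellipsoid, so it is tangent to the ellipsoid.\<close>

lemma bj_contact_point:
  assumes B: "finite B" "independent B" "span B = UNIV"
    and w: "\<And>b. b \<in> B \<Longrightarrow> w b > 0"
    and x: "norm x = 1"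
    and min: "\<And>z. norm z = 1 \<Longrightarrow>
      (\<Sum>b\<in>B. w b * (norm (representation B x b))\<^sup>2) \<le> (\<Sum>b\<in>B. w b * (norm (representation B z b))\<^sup>2)"
    and bj: "bj_orthogonal smul x y"
  shows "(\<Sum>b\<in>B. of_real (w b) * kcnj (representation B x b) * representation B y b) = 0"
    (is "?g = 0")
proof -
  define q where "q z = (\<Sum>b\<in>B. w b * (norm (representation B z b))\<^sup>2)" for z
  have q_scale: "q (smul c z) = (norm c)\<^sup>2 * q z" for c z
    by (simp add: q_def representation_scale[OF B(2)] B(3) norm_mult power_mult_distrib
        sum_distrib_left mult.left_commute)
  have q_nonneg: "q z \<ge> 0" for z
    unfolding q_def using w by (intro sum_nonneg mult_nonneg_nonneg) (auto intro: less_imp_le)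
  \<comment> \<open>Minimality on the unit sphere passes to all vectors of norm at least 1 because
    \<open>q\<close> is homogeneous of degree two.\<close>
  have q_min: "q x \<le> q z" if z: "norm z \<ge> 1" for z
  proof -
    have "q x \<le> q (smul (of_real (1 / norm z)) z)"
      unfolding q_def using z by (intro min) (auto simp: norm_scale norm_divide)
    also have "\<dots> = q z / (norm z)\<^sup>2"
      by (simp add: q_scale norm_divide power_divide)
    also have "\<dots> \<le> q z / 1"
      using z q_nonneg by (intro divide_left_mono) (auto simp: one_le_power)
    finally show ?thesis
      by simp
  qed
  have expand: "q (x + smul l y) = q x + 2 * kre (l * ?g) + (norm l)\<^sup>2 * q y" for l
  proof -
    have "w b * (norm (representation B (x + smul l y) b))\<^sup>2 =
        w b * (norm (representation B x b))\<^sup>2 +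
        2 * kre (l * (of_real (w b) * kcnj (representation B x b) * representation B y b)) +
        (norm l)\<^sup>2 * (w b * (norm (representation B y b))\<^sup>2)" for b
    proof -
      let ?x = "representation B x b" and ?y = "representation B y b"
      have "kre (l * (of_real (w b) * kcnj ?x * ?y)) = w b * kre (kcnj ?x * (l * ?y))"
        by (simp add: mult_ac flip: kre_scale)
      moreover have "representation B (x + smul l y) b = ?x + l * ?y"
        by (simp add: representation_add[OF B(2)] representation_scale[OF B(2)] B(3))
      ultimately show ?thesis
        by (simp add: norm_add_sq norm_mult power_mult_distrib algebra_simps)
    qed
    thus ?thesis
      by (simp add: q_def sum.distrib sum_distrib_left kre_sum)
  qed
  define G where "G = (norm ?g)\<^sup>2"
  \<comment> \<open>For \<open>?l\<close> below, the first-order term is \<open>- 2 * t * G\<close>,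
    while the second-order term is at most \<open>t * G\<close> because
    \<open>t * q y \<le> 1\<close>. The added 1 keeps the denominator positive.\<close>
  define t where "t = 1 / (q y + 1)"
  have t: "t > 0" "t * q y \<le> 1"
    using q_nonneg[of y] by (auto simp: t_def field_simps)
  let ?l = "of_real (- t) * kcnj ?g"
  have "1 \<le> norm (x + smul ?l y)"
    using bj x unfolding bj_orthogonal_def by metis
  hence "0 \<le> 2 * kre (?l * ?g) + (norm ?l)\<^sup>2 * q y"
    using q_min[of "x + smul ?l y"] expand[of ?l] by simp
  moreover have "kre (?l * ?g) = - t * G"
    unfolding mult.assoc kre_scale kre_kcnj_mult_self G_def ..
  moreover have "(norm ?l)\<^sup>2 = t\<^sup>2 * G"
    by (simp add: norm_mult power_mult_distrib G_def)
  ultimately have "2 * (t * G) \<le> (t * G) * (t * q y)"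
    by (simp add: power2_eq_square algebra_simps)
  also have "\<dots> \<le> t * G"
    using t by (intro mult_left_le) (auto simp: G_def)
  finally have "G \<le> 0"
    using t by (simp add: mult_le_0_iff)
  thus ?thesis
    by (simp add: G_def)
qed

text \<open>The basis contains \<open>v\<close>, and the minimiser \<open>x\<close> of the quadratic
  form \<open>q\<close> on the sphere has a nonzero \<open>v\<close>-coordinate. The tangent
  functional at \<open>x\<close> takes at \<open>v\<close> a nonzero multiple of the conjugate of
  that coordinate.\<close>

lemma ex_bj_separating_functional:
  assumes fd: "finite_dim smul" and v: "v \<noteq> 0"
  obtains x g where "linear_functional g" "g v \<noteq> 0" "\<And>y. bj_orthogonal smul x y \<Longrightarrow> g y = 0"
proof -
  obtain B0 where "finite B0" "span B0 = UNIV"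
    using fd by (auto simp: finite_dim_def)
  moreover obtain B where B: "v \<in> B" "independent B" "UNIV \<subseteq> span B"
    using maximal_independent_subset_extend[of "{v}" UNIV] v by auto
  ultimately have B: "finite B" "independent B" "span B = UNIV" "v \<in> B"
    using independent_span_bound[of B0 B] by auto
  let ?r = "representation B"
  \<comment> \<open>With this constant every unit vector has a coordinate of modulus at least
    \<open>1 / C\<close>; otherwise its norm would be at most \<open>(C - 1) / C\<close>, which is
    below 1.\<close>
  define C where "C = 1 + (\<Sum>b\<in>B. norm b)"
  have C: "C \<ge> 1"
    by (simp add: C_def sum_nonneg)
  \<comment> \<open>The weight of \<open>v\<close> is so small that \<open>q\<close> is less at \<open>v / norm v\<close> than at any unit vector whose
    \<open>v\<close>-coordinate vanishes.\<close>
  define w where "w b = (if b = v then (norm v / (2 * C))\<^sup>2 else 1)" for b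
  have w: "w b > 0" for b
    using v C by (auto simp: w_def)
  define q where "q z = (\<Sum>b\<in>B. w b * (norm (?r z b))\<^sup>2)" for z
  have "compact (cball 0 1 \<inter> span B)"
    using B(1) by (rule compact_cball_span)
  moreover have "closed (sphere (0 :: 'a) 1)"
    unfolding sphere_def by (intro closed_Collect_eq continuous_intros)
  ultimately have "compact (sphere 0 1 \<inter> (cball 0 1 \<inter> span B))"
    by (rule closed_Int_compact[rotated])
  moreover have "sphere 0 1 \<inter> (cball 0 1 \<inter> span B) = sphere 0 1"
    by (auto simp: B(3))
  ultimately have comp: "compact (sphere (0 :: 'a) 1)"
    by simp
  have cont: "continuous_on (sphere 0 1) q"
    unfolding q_def
    by (intro continuous_intros continuous_on_subset[OF continuous_on_representation[OF B(1,2)]])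
      (simp add: B(3))
  let ?v = "smul (of_real (1 / norm v)) v"
  have v1: "norm ?v = 1"
    using v by (simp add: norm_scale norm_divide)
  then obtain x where x: "norm x = 1" "\<And>z. norm z = 1 \<Longrightarrow> q x \<le> q z"
    using continuous_attains_inf[OF comp _ cont] by (force simp: set_eq_iff)
  have "?r x v \<noteq> 0"
  proof
    assume x0: "?r x v = 0"
    have "\<exists>b\<in>B. norm (?r x b) \<ge> 1 / C"
    proof (rule ccontr)
      assume "\<not> ?thesis"
      hence small: "\<And>b. b \<in> B \<Longrightarrow> norm (?r x b) \<le> 1 / C"
        by force
      have "norm x = norm (\<Sum>b\<in>B. smul (?r x b) b)"
        using sum_representation_eq[OF B(2) _ B(1) subset_refl, of x] B(3) by simp
      also have "\<dots> \<le> (\<Sum>b\<in>B. norm (?r x b) * norm b)"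
        by (rule order_trans[OF norm_sum]) (simp add: norm_scale)
      also have "\<dots> \<le> (\<Sum>b\<in>B. 1 / C * norm b)"
        using small by (intro sum_mono mult_right_mono) auto
      also have "\<dots> = (C - 1) / C"
        by (simp add: C_def sum_divide_distrib)
      also have "\<dots> < 1"
        using C by (simp add: field_simps)
      finally show False
        using x(1) by simp
    qed
    then obtain b where b: "b \<in> B" "norm (?r x b) \<ge> 1 / C"
      by blast
    hence "b \<noteq> v"
      using x0 C by auto
    \<comment> \<open>A vanishing \<open>v\<close>-coordinate would force \<open>q x\<close> to be
      at least \<open>(1 / C)\<^sup>2\<close>, four times the value of \<open>q\<close> at the
      normalised \<open>v\<close>.\<close>
    have "(1 / C)\<^sup>2 \<le> (norm (?r x b))\<^sup>2"
      using b(2) C by (intro power_mono) auto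
    also have "\<dots> = w b * (norm (?r x b))\<^sup>2"
      using \<open>b \<noteq> v\<close> by (simp add: w_def)
    also have "\<dots> \<le> q x"
      unfolding q_def using b(1) B(1) w
      by (intro member_le_sum) (auto intro!: mult_nonneg_nonneg intro: less_imp_le)
    also have "\<dots> \<le> q ?v"
      using x(2) v1 by blast
    also have "?r ?v b = (if b = v then of_real (1 / norm v) else 0)" for b
      using B by (simp add: representation_scale representation_basis)
    hence "q ?v = (\<Sum>b\<in>B. if b = v then w v * (1 / norm v)\<^sup>2 else 0)"
      unfolding q_def by (intro sum.cong) (auto simp: norm_divide)
    also have "\<dots> = (1 / (2 * C))\<^sup>2"
      using B v by (simp add: w_def power_divide power_mult_distrib)
    finally show False
      using C by (simp add: power_divide power_mult_distrib field_simps)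
  qed
  define g where "g y = (\<Sum>b\<in>B. of_real (w b) * kcnj (?r x b) * ?r y b)" for y
  show thesis
  proof (rule that[of g x])
    show "linear_functional g"
      by (rule linear_functionalI)
        (simp_all add: g_def B(3) representation_add[OF B(2)] representation_scale[OF B(2)]
          distrib_left sum.distrib sum_distrib_left mult_ac)
    have "g v = (\<Sum>b\<in>B. if b = v then of_real (w v) * kcnj (?r x v) else 0)"
      unfolding g_def by (intro sum.cong) (auto simp: representation_basis[OF B(2,4)])
    also have "\<dots> = of_real (w v) * kcnj (?r x v)"
      using B by simp
    finally show "g v \<noteq> 0"
      using w[of v] \<open>?r x v \<noteq> 0\<close> by (metis mult_eq_0_iff norm_eq_zero norm_kcnj of_real_eq_0_iff less_irrefl)
    show "g y = 0" if "bj_orthogonal smul x y" for y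
      using bj_contact_point[OF B(1-3) w x(1) x(2)[unfolded q_def] that] by (simp add: g_def)
  qed
qed


section \<open>Dimension of intersections of kernels\<close>

lemma dim_le_dim_kernel:
  assumes fd: "finite_dim smul" and f: "linear_functional f" and U: "subspace U"
  shows "dim U \<le> Suc (dim (U \<inter> {x. f x = 0}))"
proof -
  obtain B where B: "finite B" "independent B" "span B = UNIV"
    using finite_dim_basis[OF fd] .
  interpret fdvs: finite_dimensional_vector_space smul B
    using B by unfold_locales
  show ?thesis
  proof (cases "U \<subseteq> {x. f x = 0}")
    case True
    hence "U \<inter> {x. f x = 0} = U"
      by blast
    thus ?thesis
      by simp
  next
    case False
    then obtain u where u: "u \<in> U" "f u \<noteq> 0"
      by blast
    \<comment> \<open>A single vector \<open>u\<close> outside the kernel makes up for the loss: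
      subtracting a multiple of it moves any vector of \<open>U\<close> into the kernel.\<close>
    have "U \<subseteq> span (insert u (U \<inter> {x. f x = 0}))"
    proof
      fix x assume x: "x \<in> U"
      have "x - smul (f x / f u) u \<in> U \<inter> {x. f x = 0}"
        using x u U by (simp add: subspace_diff subspace_scale linear_functional_diff[OF f]
            linear_functional_scale[OF f])
      thus "x \<in> span (insert u (U \<inter> {x. f x = 0}))"
        by (auto simp: span_breakdown_eq intro: span_base)
    qed
    hence "dim U \<le> dim (insert u (U \<inter> {x. f x = 0}))"
      by (rule fdvs.dim_mono)
    also have "\<dots> \<le> Suc (dim (U \<inter> {x. f x = 0}))"
      by (simp add: fdvs.dim_insert)
    finally show ?thesis .
  qed
qed

lemma dim_le_dim_kernels:
  assumes fd: "finite_dim smul" and J: "finite J" and f: "\<And>i. i \<in> J \<Longrightarrow> linear_functional (f i)"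
  shows "dim UNIV \<le> card J + dim (\<Inter>i\<in>J. {x. f i x = 0})"
  using J f
proof (induction J rule: finite_induct)
  case (insert i J)
  have "dim UNIV \<le> card J + dim (\<Inter>i\<in>J. {x. f i x = 0})"
    using insert by simp
  also have "dim (\<Inter>i\<in>J. {x. f i x = 0}) \<le> Suc (dim ((\<Inter>i\<in>J. {x. f i x = 0}) \<inter> {x. f i x = 0}))"
    using insert.prems by (intro dim_le_dim_kernel[OF fd] subspace_kernels) auto
  also have "(\<Inter>i\<in>J. {x. f i x = 0}) \<inter> {x. f i x = 0} = (\<Inter>i\<in>insert i J. {x. f i x = 0})"
    by auto
  finally show ?case
    using insert.hyps by simp
qed simp

text \<open>Greedy selection: while the kernels chosen so far meet in too large a subspace, one more
  functional lowers its dimension.\<close>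

lemma ex_few_kernels:
  assumes fd: "finite_dim smul" and f: "\<And>i. i \<in> I \<Longrightarrow> linear_functional (f i)"
  obtains J where "J \<subseteq> I" "finite J" "(\<Inter>i\<in>J. {x. f i x = 0}) = (\<Inter>i\<in>I. {x. f i x = 0})"
    "card J + dim (\<Inter>i\<in>J. {x. f i x = 0}) \<le> dim UNIV"
proof -
  obtain B where B: "finite B" "independent B" "span B = UNIV"
    using finite_dim_basis[OF fd] .
  interpret fdvs: finite_dimensional_vector_space smul B
    using B by unfold_locales
  let ?N = "\<lambda>J. \<Inter>i\<in>J. {x. f i x = 0}"
  \<comment> \<open>The last conjunct records that the chosen functionals have lowered the dimension
    by at least their number; among such \<open>J\<close> one with an intersection of least
    dimension is taken.\<close>
  let ?P = "\<lambda>J. J \<subseteq> I \<and> finite J \<and> card J + dim (?N J) \<le> dim UNIV"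
  have "?P {}"
    by simp
  then obtain J where J: "?P J" and min: "\<And>J'. ?P J' \<Longrightarrow> dim (?N J) \<le> dim (?N J')"
    using ex_has_least_nat[of ?P "{}" "\<lambda>J. dim (?N J)"] by blast
  have "?N J = ?N I"
  proof (rule ccontr)
    assume "?N J \<noteq> ?N I"
    moreover have "?N I \<subseteq> ?N J"
      using J by blast
    ultimately obtain x i where x: "x \<in> ?N J" "i \<in> I" "f i x \<noteq> 0"
      by blast
    have sub: "subspace (?N K)" if "K \<subseteq> I" for K
      using that f by (intro subspace_kernels) auto
    have "?N (insert i J) \<subset> ?N J"
      using x by auto
    moreover have "subspace (?N (insert i J))" "subspace (?N J)"
      using J x(2) by (simp_all only: sub insert_subset simp_thms)
    ultimately have less: "dim (?N (insert i J)) < dim (?N J)"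
      by (metis fdvs.dim_psubset span_eq_iff)
    have "i \<notin> J"
      using x by auto
    hence "?P (insert i J)"
      using J x less by (auto simp del: INT_insert)
    with min less show False
      by (meson not_less)
  qed
  with J that show thesis
    by blast
qed

section \<open>Best approximation and spans in smooth spaces\<close>

lemma ex_bj_residual:
  assumes fd: "finite_dim smul" and T: "subspace T"
  obtains t where "t \<in> T" "\<And>s. s \<in> T \<Longrightarrow> bj_orthogonal smul (v - t) s"
proof -
  obtain B0 where "finite B0" "span B0 = UNIV"
    using fd by (auto simp: finite_dim_def)
  moreover obtain B where B: "B \<subseteq> T" "independent B" "T \<subseteq> span B"
    using maximal_independent_subset[of T] by blast
  ultimately have "finite B" "span B = T"
    using independent_span_bound[of B0 B] span_minimal[OF B(1) T] by auto
  \<comment> \<open>Points of \<open>T\<close> of norm above \<open>2 * norm v\<close> approximate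
    \<open>v\<close> worse than 0 does, so a compact piece of \<open>T\<close> suffices.\<close>
  hence comp: "compact (cball 0 (2 * norm v) \<inter> T)"
    using compact_cball_span by blast
  have "0 \<in> cball 0 (2 * norm v) \<inter> T"
    using subspace_0[OF T] by simp
  hence ne: "cball 0 (2 * norm v) \<inter> T \<noteq> {}"
    by blast
  have "continuous_on (cball 0 (2 * norm v) \<inter> T) (\<lambda>t. norm (v - t))"
    by (intro continuous_intros)
  from continuous_attains_inf[OF comp ne this] obtain t where t: "t \<in> T"
    "\<And>s. s \<in> T \<Longrightarrow> norm s \<le> 2 * norm v \<Longrightarrow> norm (v - t) \<le> norm (v - s)"
    by auto
  have t_min: "norm (v - t) \<le> norm (v - s)" if s: "s \<in> T" for s
  proof (cases "norm s \<le> 2 * norm v")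
    case False
    have "norm s \<le> norm v + norm (v - s)"
      by (metis norm_triangle_sub norm_minus_commute)
    moreover have "norm (v - t) \<le> norm v"
      using t(2)[of 0] subspace_0[OF T] by simp
    ultimately show ?thesis
      using False by simp
  qed (use s t in blast)
  have "bj_orthogonal smul (v - t) s" if s: "s \<in> T" for s
    unfolding bj_orthogonal_def
  proof
    fix l
    have "t - smul l s \<in> T"
      using s t(1) T by (simp add: subspace_diff subspace_scale)
    thus "norm (v - t) \<le> norm (v - t + smul l s)"
      using t_min[of "t - smul l s"] by (simp add: algebra_simps)
  qed
  with t(1) that show thesis
    by blast
qed

text \<open>Smoothness enters twice: it makes each outgoing neighbourhood a subspace, which gives
  one inclusion, and it lets orthogonality of \<open>v - t\<close> to \<open>v\<close> and to
  \<open>t\<close> combine into orthogonality to itself, so that \<open>v = t\<close>.\<close>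

lemma smooth_span_eq:
  assumes fd: "finite_dim smul" and sm: "smooth_space smul"
  shows "span S = (\<Inter>x\<in>{x. \<forall>s\<in>S. bj_orthogonal smul x s}. {y. bj_orthogonal smul x y})"
proof (intro equalityI subsetI)
  fix v assume v: "v \<in> span S"
  have "bj_orthogonal smul x v" if x: "\<forall>s\<in>S. bj_orthogonal smul x s" for x
  proof -
    obtain f where f: "linear_functional f" "\<And>y. bj_orthogonal smul x y \<longleftrightarrow> f y = 0"
      using smooth_bj_iff_kernel[OF sm, of x] by metis
    have "span S \<subseteq> {y. f y = 0}"
      using x f by (intro span_minimal subspace_kernel) auto
    thus ?thesis
      using v f by auto
  qed
  thus "v \<in> (\<Inter>x\<in>{x. \<forall>s\<in>S. bj_orthogonal smul x s}. {y. bj_orthogonal smul x y})"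
    by blast
next
  fix v assume v: "v \<in> (\<Inter>x\<in>{x. \<forall>s\<in>S. bj_orthogonal smul x s}. {y. bj_orthogonal smul x y})"
  obtain t where t: "t \<in> span S" "\<And>s. s \<in> span S \<Longrightarrow> bj_orthogonal smul (v - t) s"
    using ex_bj_residual[OF fd subspace_span[of S], of v] by blast
  have "bj_orthogonal smul (v - t) v"
    using v t(2) by (auto intro: span_base)
  moreover have "bj_orthogonal smul (v - t) t"
    using t by blast
  moreover obtain f where f: "linear_functional f" "\<And>y. bj_orthogonal smul (v - t) y \<longleftrightarrow> f y = 0"
    using smooth_bj_iff_kernel[OF sm, of "v - t"] by metis
  ultimately have "f (v - t) = 0"
    by (simp add: linear_functional_diff[OF f(1)])
  hence "bj_orthogonal smul (v - t) (v - t)"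
    using f(2) by blast
  thus "v \<in> span S"
    using t by simp
qed

end

section \<open>Auerbach systems\<close>

lemma continuous_on_det:
  fixes A :: "'a::topological_space \<Rightarrow> nat \<Rightarrow> nat \<Rightarrow> 'b::real_normed_field"
  assumes "\<And>i j. i < n \<Longrightarrow> j < n \<Longrightarrow> continuous_on S (\<lambda>x. A x i j)"
  shows "continuous_on S (\<lambda>x. det (mat n n (\<lambda>(i, j). A x i j)))"
proof -
  have less: "p i < n" if "p permutes {0..<n}" "i < n" for p i
    using permutes_in_image[OF that(1), of i] that(2) by simp
  have "det (mat n n (\<lambda>(i, j). A x i j)) =
      (\<Sum>p\<in>{p. p permutes {0..<n}}. signof p * (\<Prod>i=0..<n. A x i (p i)))" for x
    by (subst det_def'[where n = n])
      (auto intro!: sum.cong prod.cong arg_cong2[of _ _ _ _ "(*)"] simp: less)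
  thus ?thesis
    by (auto intro!: continuous_intros assms simp: less)
qed

text \<open>The cofactors along row \<open>i\<close> do not involve that row, so the coefficients
  \<open>c\<close> are the same for every replacement \<open>a\<close>.\<close>

lemma det_fun_upd_row:
  fixes A :: "nat \<Rightarrow> nat \<Rightarrow> 'b::comm_ring_1"
  assumes i: "i < n"
  obtains c where "\<And>a. det (mat n n (\<lambda>(k, j). (A(i := a)) k j)) = (\<Sum>j<n. a j * c j)"
proof -
  let ?M = "\<lambda>a. mat n n (\<lambda>(k, j). (A(i := a)) k j)"
  have "det (?M a) = (\<Sum>j<n. a j * cofactor (?M (A i)) i j)" for a
  proof -
    have "mat_delete (?M a) i j = mat_delete (?M (A i)) i j" for j
      by (rule eq_matI) (auto simp: mat_delete_def)
    hence cofactor_eq: "cofactor (?M a) i j = cofactor (?M (A i)) i j" for j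
      by (simp only: cofactor_def)
    have "det (?M a) = (\<Sum>j<n. ?M a $$ (i, j) * cofactor (?M a) i j)"
      by (rule laplace_expansion_row[OF _ i]) simp
    thus ?thesis
      unfolding cofactor_eq using i by simp
  qed
  thus thesis
    by (rule that)
qed

context normed_space_over
begin

text \<open>Vectors of the unit ball that maximise the modulus of the determinant of their coordinates
  form an Auerbach system: expanding along row \<open>i\<close> yields a functional which is maximal at the
  \<open>i\<close>-th vector and vanishes at all others.\<close>

lemma Auerbach_clique:
  assumes B: "finite B" "independent B"
  obtains K where "finite K" "card K = card B"
    "\<And>u v. u \<in> K \<Longrightarrow> v \<in> K \<Longrightarrow> u \<noteq> v \<Longrightarrow> bj_orthogonal smul u v"
proof -
  define n where "n = card B"
  obtain e where e: "bij_betw e {0..<n} B"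
    using ex_bij_betw_nat_finite[OF B(1)] by (auto simp: n_def)
  hence eB: "e i \<in> B" if "i < n" for i
    using that by (auto simp: bij_betw_def)
  have e_eq: "e i = e j \<longleftrightarrow> i = j" if "i < n" "j < n" for i j
    using e that by (auto simp: bij_betw_def inj_on_def)
  define D where "D X = det (mat n n (\<lambda>(i, j). representation B (X i) (e j)))" for X
  define K0 where "K0 = cball 0 1 \<inter> span B"
  \<comment> \<open>Entries from index \<open>n\<close> on are pinned to 0, so that tuples become
    functions on all naturals and Tychonoff's theorem gives compactness.\<close>
  define P where "P = PiE UNIV (\<lambda>i. if i < n then K0 else {0})"
  have P_iff: "X \<in> P \<longleftrightarrow> (\<forall>i<n. X i \<in> K0) \<and> (\<forall>i\<ge>n. X i = 0)" for X
  proof -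
    have "X \<in> P \<longleftrightarrow> (\<forall>i. X i \<in> (if i < n then K0 else {0}))"
      by (simp add: P_def PiE_iff extensional_def)
    moreover have "X i \<in> (if i < n then K0 else {0}) \<longleftrightarrow> (i < n \<longrightarrow> X i \<in> K0) \<and> (i \<ge> n \<longrightarrow> X i = 0)" for i
      by simp
    ultimately show ?thesis
      by blast
  qed
  have "compact K0"
    unfolding K0_def using B(1) by (rule compact_cball_span)
  hence "compactin (product_topology (\<lambda>_. euclidean) UNIV) P"
    unfolding P_def compactin_PiE by (simp add: compactin_euclidean_iff)
  hence P: "compact P"
    by (simp add: euclidean_product_topology compactin_euclidean_iff)
  have cont: "continuous_on P (\<lambda>X. norm (D X))"
    unfolding D_def
  proof (intro continuous_on_norm continuous_on_det)
    fix i j assume "i < n" "j < n"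
    show "continuous_on P (\<lambda>X. representation B (X i) (e j))"
      by (rule continuous_on_compose2[OF continuous_on_representation[OF B]
            continuous_on_subset[OF continuous_on_product_coordinates]])
        (use \<open>i < n\<close> in \<open>auto simp: P_iff K0_def\<close>)
  qed
  \<comment> \<open>Shrinking the basis by a common factor puts it into the unit ball; its
    determinant is a nonzero power, so the maximum is not 0.\<close>
  define \<sigma> where "\<sigma> = (\<Sum>b\<in>B. norm b)"
  define Y where "Y i = (if i < n then smul (of_real (1 / \<sigma>)) (e i) else 0)" for i
  have \<sigma>: "0 < \<sigma>" "norm (e i) \<le> \<sigma>" if "i < n" for i
  proof -
    have "0 < norm (e i)"
      using eB[OF that] B(2) dependent_zero by auto
    moreover show "norm (e i) \<le> \<sigma>"
      unfolding \<sigma>_def using eB[OF that] B(1) by (intro member_le_sum) auto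
    ultimately show "0 < \<sigma>"
      by (rule less_le_trans)
  qed
  have "Y i \<in> K0" if "i < n" for i
    using \<sigma>[OF that] eB[OF that] that
    by (auto simp: K0_def Y_def norm_scale norm_divide intro: span_scale span_base)
  hence YP: "Y \<in> P"
    by (simp add: P_iff Y_def)
  have "P \<noteq> {}"
    using YP by blast
  from continuous_attains_sup[OF P this cont] obtain X
    where X: "X \<in> P" and X_max: "\<And>Z. Z \<in> P \<Longrightarrow> norm (D Z) \<le> norm (D X)"
    by blast
  have "D Y \<noteq> 0"
  proof -
    have "mat n n (\<lambda>(i, j). representation B (Y i) (e j)) = of_real (1 / \<sigma>) \<cdot>\<^sub>m 1\<^sub>m n"
      by (rule eq_matI) (auto simp: Y_def representation_scale[OF B(2)] span_base eB
          representation_basis[OF B(2)] e_eq)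
    hence "D Y = of_real (1 / \<sigma>) ^ n"
      by (simp add: D_def)
    moreover have "\<sigma> \<noteq> 0" if "n \<noteq> 0"
      using \<sigma>(1)[of 0] that by simp
    ultimately show ?thesis
      by (cases "n = 0") auto
  qed
  hence DX: "D X \<noteq> 0"
    using X_max[OF YP] by auto
  have XB: "X i \<in> span B" "norm (X i) \<le> 1" if "i < n" for i
    using X that by (auto simp: P_iff K0_def)
  have D_upd: "\<exists>c. \<forall>y. D (X(i := y)) = (\<Sum>j<n. representation B y (e j) * c j)" if i: "i < n" for i
  proof -
    obtain c where c: "\<And>a. det (mat n n (\<lambda>(k, j). ((\<lambda>k j. representation B (X k) (e j))(i := a)) k j)) =
        (\<Sum>j<n. a j * c j)"
      using det_fun_upd_row[OF i, of "\<lambda>k j. representation B (X k) (e j)"] by blast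
    have "D (X(i := y)) = (\<Sum>j<n. representation B y (e j) * c j)" for y
      unfolding c[of "\<lambda>j. representation B y (e j)", symmetric] D_def
      by (intro arg_cong[of _ _ det] eq_matI) auto
    thus ?thesis
      by blast
  qed
  have D_add: "D (X(i := y + smul l z)) = D (X(i := y)) + l * D (X(i := z))"
    if "i < n" "y \<in> span B" "z \<in> span B" for i y z l
  proof -
    obtain c where c: "\<And>y. D (X(i := y)) = (\<Sum>j<n. representation B y (e j) * c j)"
      using D_upd[OF \<open>i < n\<close>] by blast
    have "representation B (y + smul l z) b = representation B y b + l * representation B z b" for b
      using that by (simp add: representation_add[OF B(2)] representation_scale[OF B(2)] span_scale)
    thus ?thesis
      by (simp add: c distrib_right sum.distrib sum_distrib_left mult.assoc)
  qed
  have D_zero: "D (X(i := 0)) = 0" if "i < n" for i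
    using D_add[OF that, of 0 0 1] by (simp add: span_zero)
  have D_eq: "D Z = 0" if "i < n" "k < n" "i \<noteq> k" "Z i = Z k" for i k Z
    unfolding D_def by (rule det_identical_rows[OF _ that(3,1,2)]) (use that in auto)
  \<comment> \<open>Maximality over the unit ball is extended by homogeneity: on the span, the
    functional of row \<open>i\<close> has norm at most \<open>norm (D X)\<close>.\<close>
  have D_le: "norm (D (X(i := y))) \<le> norm (D X) * norm y" if i: "i < n" and y: "y \<in> span B" for i y
  proof (cases "y = 0")
    case True
    thus ?thesis
      using D_zero[OF i] by simp
  next
    case False
    let ?y = "smul (of_real (1 / norm y)) y"
    have "?y \<in> K0"
      using False y by (auto simp: K0_def norm_scale norm_divide intro: span_scale)
    hence "X(i := ?y) \<in> P"
      using X i by (auto simp: P_iff)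
    hence "norm (D (X(i := ?y))) \<le> norm (D X)"
      by (rule X_max)
    moreover have "D (X(i := ?y)) = of_real (1 / norm y) * D (X(i := y))"
      using D_add[OF i span_zero y, of "of_real (1 / norm y)"] D_zero[OF i] by simp
    hence "norm (D (X(i := ?y))) = norm (D (X(i := y))) / norm y"
      by (simp add: norm_divide)
    ultimately show ?thesis
      using False by (simp add: pos_divide_le_eq)
  qed
  have inj: "inj_on X {..<n}"
    using DX D_eq by (auto simp: inj_on_def)
  show thesis
  proof (rule that[of "X ` {..<n}"])
    show "card (X ` {..<n}) = card B"
      using card_image[OF inj] by (simp add: n_def)
    fix u v assume "u \<in> X ` {..<n}" "v \<in> X ` {..<n}" "u \<noteq> v"
    then obtain i k where ik: "i < n" "k < n" "i \<noteq> k" "u = X i" "v = X k"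
      by auto
    show "bj_orthogonal smul u v"
      unfolding bj_orthogonal_def
    proof
      fix l
      \<comment> \<open>Adding a multiple of row \<open>k\<close> to row \<open>i\<close> leaves the
        determinant unchanged, so \<open>D_le\<close> bounds the norm of the perturbed vector from
        below.\<close>
      have "D (X(i := X i + smul l (X k))) = D X"
        using D_add[OF ik(1) XB(1)[OF ik(1)] XB(1)[OF ik(2)], of l] ik
          D_eq[OF ik(1-3), of "X(i := X k)"] by simp
      hence "norm (D X) \<le> norm (D X) * norm (X i + smul l (X k))"
        using D_le[OF ik(1), of "X i + smul l (X k)"] XB(1) ik by (simp add: span_add span_scale)
      hence "1 \<le> norm (X i + smul l (X k))"
        using DX by simp
      thus "norm u \<le> norm (u + smul l v)"
        using XB(2)[OF ik(1)] ik by simp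
    qed
  qed simp
qed

end

section \<open>The orthogonality digraph\<close>

lemma dominates_Gamma0: "x \<rightarrow>\<^bsub>Gamma0 smul\<^esub> y \<longleftrightarrow> bj_orthogonal smul x y"
  by (auto simp: Gamma0_def arcs_ends_def arc_to_ends_def image_iff)

lemma out_nbhd_Gamma0: "out_nbhd (Gamma0 smul) x = {y. bj_orthogonal smul x y}"
  by (auto simp: out_nbhd_def dominates_Gamma0) (auto simp: Gamma0_def)

lemma verts_Gamma0: "verts (Gamma0 smul) = UNIV"
  by (simp add: Gamma0_def)

lemma is_clique_Gamma0:
  "is_clique (Gamma0 smul) K \<longleftrightarrow> (\<forall>u\<in>K. \<forall>v\<in>K. u \<noteq> v \<longrightarrow> bj_orthogonal smul u v)"
  by (auto simp: is_clique_def dominates_Gamma0 verts_Gamma0)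

context normed_space_over
begin

section \<open>Finiteness of the clique number\<close>

lemma clique_number_finite:
  assumes "finite_dim smul"
  shows "clique_number (Gamma0 smul) < \<infinity>"
proof -
  obtain B where "finite B" "span B = UNIV"
    using assms by (auto simp: finite_dim_def)
  hence "compact (cball (0 :: 'a) 1)"
    using compact_cball_span[of B 1] by simp
  hence "\<forall>e>0. \<exists>C. finite C \<and> cball (0 :: 'a) 1 \<subseteq> (\<Union>c\<in>C. ball c e)"
    by (simp add: compact_eq_totally_bounded)
  from this[rule_format, of "1 / 2"]
  obtain C where C: "finite C" "cball (0 :: 'a) 1 \<subseteq> (\<Union>c\<in>C. ball c (1 / 2))"
    by auto
  \<comment> \<open>The extra 1 accounts for the zero vector, which can be added to any
    clique.\<close>
  have "ecard K \<le> enat (Suc (card C))" if K: "is_clique (Gamma0 smul) K" for K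
  proof -
    let ?n = "\<lambda>u. smul (of_real (1 / norm u)) u :: 'a"
    have "\<exists>c\<in>C. dist c (?n u) < 1 / 2" for u
    proof -
      have "?n u \<in> cball 0 1"
        by (simp add: norm_scale norm_divide)
      with C(2) show ?thesis
        by (auto simp: subset_iff)
    qed
    then obtain c where c: "\<And>u. c u \<in> C" "\<And>u. dist (c u) (?n u) < 1 / 2"
      by metis
    \<comment> \<open>Normalised orthogonal vectors are at distance at least 1, but two vectors
      sharing a centre would be closer than that.\<close>
    have inj: "inj_on c (K - {0})"
    proof (rule inj_onI, rule ccontr)
      fix u v assume uv: "u \<in> K - {0}" "v \<in> K - {0}" "c u = c v" "u \<noteq> v"
      have "bj_orthogonal smul (?n u) (?n v)"
        using K uv by (intro bj_scale_left bj_scale_right) (auto simp: is_clique_Gamma0)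
      hence "norm (?n u) \<le> norm (?n u + smul (- 1) (?n v))"
        unfolding bj_orthogonal_def by blast
      moreover have "norm (?n u) = 1"
        using uv by (simp add: norm_scale norm_divide)
      moreover have "dist (?n u) (?n v) < 1"
        using dist_triangle_half_r[OF c(2)[of u], of "?n v"] c(2)[of v] uv(3) by simp
      ultimately show False
        by (simp add: dist_norm)
    qed
    hence fin: "finite (K - {0})"
      using C(1) c(1) by (metis finite_imageD finite_subset image_subsetI)
    have "card K \<le> card (insert 0 (K - {0}))"
      using fin by (intro card_mono) auto
    also have "\<dots> \<le> Suc (card (K - {0}))"
      by (rule card_insert_le_m1) simp_all
    also have "\<dots> \<le> Suc (card C)"
      using inj C(1) c(1) by (simp add: card_inj_on_le image_subsetI)
    finally show ?thesis
      using fin by (simp add: ecard_def)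
  qed
  hence "clique_number (Gamma0 smul) \<le> enat (Suc (card C))"
    unfolding clique_number_def by (intro SUP_least) auto
  also have "enat (Suc (card C)) < \<infinity>"
    by simp
  finally show ?thesis .
qed

lemma ex_independent_card:
  assumes "\<not> finite_dim smul"
  obtains B where "finite B" "independent B" "card B = n"
proof -
  have "\<exists>B. finite B \<and> independent B \<and> card B = n"
  proof (induction n)
    case 0
    show ?case
      by (intro exI[of _ "{}"]) (simp add: independent_empty)
  next
    case (Suc n)
    then obtain B where B: "finite B" "independent B" "card B = n"
      by blast
    then obtain b where b: "b \<notin> span B"
      using assms by (auto simp: finite_dim_def)
    hence "b \<notin> B"
      using span_base by blast
    with B b show ?case
      by (intro exI[of _ "insert b B"]) (simp add: independent_insertI)
  qed
  with that show thesis
    by blast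
qed

lemma finite_dim_iff_clique_number:
  "finite_dim smul \<longleftrightarrow> clique_number (Gamma0 smul) < \<infinity>"
proof (rule iffI[OF clique_number_finite], assumption, rule ccontr)
  assume less: "clique_number (Gamma0 smul) < \<infinity>" and inf: "\<not> finite_dim smul"
  from less obtain N where N: "clique_number (Gamma0 smul) = enat N"
    by (cases "clique_number (Gamma0 smul)") auto
  obtain B where B: "finite B" "independent B" "card B = Suc N"
    using ex_independent_card[OF inf] by blast
  obtain K where K: "finite K" "card K = card B"
    "\<And>u v. u \<in> K \<Longrightarrow> v \<in> K \<Longrightarrow> u \<noteq> v \<Longrightarrow> bj_orthogonal smul u v"
    using Auerbach_clique[OF B(1,2)] by blast
  hence "is_clique (Gamma0 smul) K"
    by (simp add: is_clique_Gamma0)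
  hence "ecard K \<le> clique_number (Gamma0 smul)"
    unfolding clique_number_def by (intro SUP_upper) simp
  thus False
    using K B by (simp add: N ecard_def)
qed

text \<open>Outgoing neighbourhoods need not be subspaces, so they are compared with kernels from
  both sides: kernels inside them give the lower bound, kernels containing them give a family that
  attains it.\<close>

lemma dim_is_minimum:
  assumes fd: "finite_dim smul"
  shows "is_minimum (dim UNIV)
    {card \<Omega> | \<Omega>. finite \<Omega> \<and> card (\<Inter>x\<in>\<Omega>. {y. bj_orthogonal smul x y}) = 1}"
proof -
  have lower: "dim UNIV \<le> card \<Omega>"
    if \<Omega>: "finite \<Omega>" "card (\<Inter>x\<in>\<Omega>. {y. bj_orthogonal smul x y}) = 1" for \<Omega>
  proof -
    have "\<exists>f. linear_functional f \<and> (\<forall>y. f y = 0 \<longrightarrow> bj_orthogonal smul x y)" for x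
      using ex_kernel_subset_bj[of x] by metis
    then obtain f where f: "\<And>x. linear_functional (f x)"
      "\<And>x y. f x y = 0 \<Longrightarrow> bj_orthogonal smul x y"
      by metis
    obtain z where z: "(\<Inter>x\<in>\<Omega>. {y. bj_orthogonal smul x y}) = {z}"
      using \<Omega>(2) by (auto simp: card_1_singleton_iff)
    \<comment> \<open>Zero lies in every outgoing neighbourhood, so an intersection with one element
      must be \<open>{0}\<close>.\<close>
    have "0 \<in> (\<Inter>x\<in>\<Omega>. {y. bj_orthogonal smul x y})"
      by simp
    hence "(\<Inter>x\<in>\<Omega>. {y. bj_orthogonal smul x y}) = {0}"
      using z by simp
    moreover have "(\<Inter>x\<in>\<Omega>. {y. f x y = 0}) \<subseteq> (\<Inter>x\<in>\<Omega>. {y. bj_orthogonal smul x y})"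
      using f(2) by blast
    ultimately have "(\<Inter>x\<in>\<Omega>. {y. f x y = 0}) \<subseteq> span {}"
      by simp
    hence "dim (\<Inter>x\<in>\<Omega>. {y. f x y = 0}) \<le> card ({} :: 'a set)"
      by (rule dim_le_card) simp
    thus ?thesis
      using dim_le_dim_kernels[OF fd \<Omega>(1), of f] f(1) by simp
  qed
  \<comment> \<open>Each vertex is paired with the functionals vanishing on its neighbourhood. By
    \<open>ex_bj_separating_functional\<close> all these kernels meet only in 0, and at most
    \<open>dim UNIV\<close> of them already do.\<close>
  let ?I = "{(x, g). linear_functional g \<and> (\<forall>y. bj_orthogonal smul x y \<longrightarrow> g y = 0)}"
  have lin: "\<And>i. i \<in> ?I \<Longrightarrow> linear_functional (snd i)"
    by auto
  obtain J where J: "J \<subseteq> ?I" "finite J"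
    "(\<Inter>i\<in>J. {x. snd i x = 0}) = (\<Inter>i\<in>?I. {x. snd i x = 0})"
    "card J + dim (\<Inter>i\<in>J. {x. snd i x = 0}) \<le> dim UNIV"
    using ex_few_kernels[OF fd, of ?I snd, OF lin] .
  have "v = 0" if v: "v \<in> (\<Inter>i\<in>?I. {x. snd i x = 0})" for v
  proof (rule ccontr)
    assume "v \<noteq> 0"
    then obtain x g where "linear_functional g" "g v \<noteq> 0" "\<And>y. bj_orthogonal smul x y \<Longrightarrow> g y = 0"
      using ex_bj_separating_functional[OF fd] by metis
    thus False
      using v by force
  qed
  moreover have "(\<Inter>x\<in>fst ` J. {y. bj_orthogonal smul x y}) \<subseteq> (\<Inter>i\<in>J. {x. snd i x = 0})"
    using J(1) by force
  ultimately have "(\<Inter>x\<in>fst ` J. {y. bj_orthogonal smul x y}) = {0}"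
    using J(3) by auto
  hence one: "card (\<Inter>x\<in>fst ` J. {y. bj_orthogonal smul x y}) = 1"
    by simp
  \<comment> \<open>Distinct pairs may share a vertex, so the image could be smaller than
    \<open>J\<close>; the lower bound still forces equality.\<close>
  have "card (fst ` J) = dim UNIV"
    using lower[OF finite_imageI[OF J(2)] one] card_image_le[OF J(2), of fst] J(4) by simp
  thus ?thesis
    unfolding is_minimum_def using one J(2) lower by (auto intro!: exI[of _ "fst ` J"])
qed

lemma smooth_codim_is_minimum:
  assumes fd: "finite_dim smul" and sm: "smooth_space smul"
  shows "\<exists>m::nat. is_minimum (enat m)
      {ecard \<Omega> | \<Omega>. (\<Inter>x\<in>{x \<in> \<Omega>. \<forall>s\<in>S. bj_orthogonal smul x s}. {y. bj_orthogonal smul x y}) = span S}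
    \<and> int (dim (span S)) = int (dim UNIV) - int m"
proof -
  have "\<exists>f. linear_functional f \<and> (\<forall>y. bj_orthogonal smul x y \<longleftrightarrow> f y = 0)" for x
    using smooth_bj_iff_kernel[OF sm, of x] by metis
  then obtain f where f: "\<And>x. linear_functional (f x)"
    "\<And>x y. bj_orthogonal smul x y \<longleftrightarrow> f x y = 0"
    by metis
  let ?I = "\<lambda>\<Omega>. {x \<in> \<Omega>. \<forall>s\<in>S. f x s = 0}"
  have lower: "dim UNIV \<le> card \<Omega> + dim (span S)"
    if \<Omega>: "finite \<Omega>" "(\<Inter>x\<in>?I \<Omega>. {y. f x y = 0}) = span S" for \<Omega>
  proof -
    have "dim UNIV \<le> card (?I \<Omega>) + dim (\<Inter>x\<in>?I \<Omega>. {y. f x y = 0})"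
      using \<Omega>(1) by (intro dim_le_dim_kernels[OF fd] f(1)) simp
    also have "\<dots> \<le> card \<Omega> + dim (span S)"
      unfolding \<Omega>(2) using \<Omega>(1) by (intro add_mono card_mono) auto
    finally show ?thesis .
  qed
  obtain J where J: "J \<subseteq> ?I UNIV" "finite J"
    "(\<Inter>x\<in>J. {y. f x y = 0}) = (\<Inter>x\<in>?I UNIV. {y. f x y = 0})"
    "card J + dim (\<Inter>x\<in>J. {y. f x y = 0}) \<le> dim UNIV"
    using ex_few_kernels[OF fd, of "?I UNIV" f] f(1) by blast
  have span: "(\<Inter>x\<in>J. {y. f x y = 0}) = span S"
    using J(3) smooth_span_eq[OF fd sm, of S] by (simp add: f(2))
  \<comment> \<open>Every vertex selected in \<open>J\<close> is already orthogonal to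
    \<open>S\<close>, so restricting \<open>J\<close> to such vertices changes nothing.\<close>
  have "?I J = J"
    using J(1) by blast
  hence IJ: "(\<Inter>x\<in>?I J. {y. f x y = 0}) = span S"
    using span by simp
  have card: "card J + dim (span S) = dim UNIV"
    using lower[OF J(2) IJ] J(4) unfolding span by simp
  have "is_minimum (enat (card J)) {ecard \<Omega> | \<Omega>. (\<Inter>x\<in>?I \<Omega>. {y. f x y = 0}) = span S}"
    unfolding is_minimum_def
  proof
    show "enat (card J) \<in> {ecard \<Omega> | \<Omega>. (\<Inter>x\<in>?I \<Omega>. {y. f x y = 0}) = span S}"
      using IJ J(2) by (auto simp: ecard_def)
    have "enat (card J) \<le> ecard \<Omega>" if "(\<Inter>x\<in>?I \<Omega>. {y. f x y = 0}) = span S" for \<Omega>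
      using lower[OF _ that] card by (cases "finite \<Omega>") (auto simp: ecard_def)
    thus "\<forall>a\<in>{ecard \<Omega> | \<Omega>. (\<Inter>x\<in>?I \<Omega>. {y. f x y = 0}) = span S}. enat (card J) \<le> a"
      by blast
  qed
  moreover have "int (dim (span S)) = int (dim UNIV) - int (card J)"
    using card by simp
  ultimately show ?thesis
    unfolding f(2) by blast
qed

end

theorem theorem1p1:
  fixes smul :: "'k::real_or_complex \<Rightarrow> 'a::real_normed_vector \<Rightarrow> 'a"
  assumes "normed_space_over smul"
  shows
    "(finite_dim smul \<longleftrightarrow> clique_number (Gamma0 smul) < \<infinity>) \<and>
     (clique_number (Gamma0 smul) < \<infinity> \<longrightarrow>
        is_minimum (vector_space.dim smul UNIV)
          {card \<Omega> | \<Omega>. \<Omega> \<subseteq> verts (Gamma0 smul) \<and> finite \<Omega> \<and>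
             card (\<Inter>x\<in>\<Omega>. out_nbhd (Gamma0 smul) x) = 1}) \<and>
     (finite_dim smul \<and> smooth_space smul \<longrightarrow>
        (\<forall>S. S \<subseteq> verts (Gamma0 smul) \<longrightarrow>
           module.span smul S =
             (\<Inter>x \<in> {x \<in> verts (Gamma0 smul). \<forall>s\<in>S. x \<rightarrow>\<^bsub>Gamma0 smul\<^esub> s}.
                out_nbhd (Gamma0 smul) x) \<and>
           (\<exists>m::nat.
              is_minimum (enat m)
                {ecard \<Omega> | \<Omega>. \<Omega> \<subseteq> verts (Gamma0 smul) \<and>
                   (\<Inter>x \<in> {x \<in> \<Omega>. \<forall>s\<in>S. x \<rightarrow>\<^bsub>Gamma0 smul\<^esub> s}.
                      out_nbhd (Gamma0 smul) x) = module.span smul S} \<and>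
              int (vector_space.dim smul (module.span smul S)) =
                int (vector_space.dim smul UNIV) - int m)))"
proof -
  interpret normed_space_over smul
    by (fact assms)
  show ?thesis
    unfolding verts_Gamma0 out_nbhd_Gamma0 dominates_Gamma0
    using finite_dim_iff_clique_number dim_is_minimum smooth_span_eq smooth_codim_is_minimum
    by simp
qed

end
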